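(* Let $G$ be a finite simple undirected graph on $n$ vertices. For every real $p>0$ and every $\sigma\in\{+,-\}$, $$\mathcal E_p^\sigma(G)\ge\begin{cases}\left(n-\kappa(G)\right)^{p/2},&0<p\le 2,\\ n-\kappa(G),&p\ge 2.\end{cases}$$
   Context: All graphs are finite, simple, and undirected. For a graph $G$ with $n$ vertices, let $\lambda_1,\ldots,\lambda_n$ be the (real) eigenvalues of its adjacency matrix, counted with multiplicity. For real $p>0$, the positive and negative $p$-energies of $G$ are $$\mathcal E_p^+(G):=\sum_{\lambda_i>0}|\lambda_i|^p,\qquad \mathcal E_p^-(G):=\sum_{\lambda_i<0}|\lambda_i|^p.$$ $\kappa(G)$ denotes the number of connected components of $G$ (isolated vertices count as components). *)

theory Defs
  imports "Jordan_Normal_Form.Char_Poly" "Graph_Theory.Digraph_Component"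
begin

text \<open>
  Finite simple undirected graphs are the instances of the locale \<^locale>\<open>graph\<close>: finite,
  loop-free, symmetric digraphs without parallel arcs, an edge being a pair of opposite arcs.
\<close>

text \<open>The adjacency matrix with respect to an enumeration \<open>vs\<close> of the vertices.\<close>

definition adjacency_matrix :: "('a, 'b) pre_digraph \<Rightarrow> 'a list \<Rightarrow> real mat" where
  "adjacency_matrix G vs =
     mat (length vs) (length vs) (\<lambda>(i, j). of_bool ((vs ! i, vs ! j) \<in> arcs_ends G))"

text \<open>
  The multiset of eigenvalues, i.e. of roots of the characteristic polynomial with their
  multiplicities. The adjacency matrix is symmetric, so no eigenvalue is lost by working over the
  reals. The enumeration of the vertices is irrelevant, see \<open>adjacency_eigenvalues_eq\<close> below.
\<close>

definition adjacency_eigenvalues :: "('a, 'b) pre_digraph \<Rightarrow> real multiset" where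
  "adjacency_eigenvalues G =
     proots (char_poly (adjacency_matrix G (SOME vs. distinct vs \<and> set vs = verts G)))"

lemma similar_adjacency_matrix:
  assumes vs: "distinct vs" and ws: "distinct ws" and eq: "set vs = set ws"
  shows "similar_mat (adjacency_matrix G vs) (adjacency_matrix G ws)"
proof -
  define n where "n = length vs"
  have lv: "length vs = n" by (simp add: n_def)
  have lw: "length ws = n"
    using distinct_card[OF vs] distinct_card[OF ws] eq by (simp add: n_def)
  define P where "P xs ys = mat n n (\<lambda>(i, j). (of_bool (xs ! i = ys ! j) :: real))"
    for xs ys :: "'a list"
  have PP: "P xs ys * P ys xs = 1\<^sub>m n"
    if dist: "distinct xs" "distinct ys" and sets: "set xs = set ys"
      and len: "length xs = n" "length ys = n" for xs ys
  proof (rule eq_matI)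
    fix i j assume "i < dim_row (1\<^sub>m n)" "j < dim_col (1\<^sub>m n)"
    then have i: "i < n" and j: "j < n" by auto
    have "xs ! i \<in> set ys"
      using nth_mem[of i xs] sets len i by simp
    then obtain k where k: "k < n" "ys ! k = xs ! i"
      unfolding in_set_conv_nth len by blast
    have uk: "xs ! i = ys ! l \<longleftrightarrow> l = k" if "l < n" for l
      unfolding k(2)[symmetric] using nth_eq_iff_index_eq[OF dist(2), of k l] that k(1) len(2) by auto
    have "(P xs ys * P ys xs) $$ (i, j)
        = (\<Sum>l = 0..<n. of_bool (xs ! i = ys ! l) * of_bool (ys ! l = xs ! j))"
      using i j by (simp add: P_def scalar_prod_def)
    also have "\<dots> = (\<Sum>l = 0..<n. if l = k then of_bool (xs ! i = xs ! j) else 0)"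
      by (rule sum.cong) (auto simp: uk k(2))
    also have "\<dots> = of_bool (xs ! i = xs ! j)"
      using k(1) by simp
    also have "\<dots> = 1\<^sub>m n $$ (i, j)"
      using nth_eq_iff_index_eq[OF dist(1), of i j] i j len(1) by simp
    finally show "(P xs ys * P ys xs) $$ (i, j) = 1\<^sub>m n $$ (i, j)" .
  qed (simp_all add: P_def)
  have idx: "\<exists>k<n. vs ! i = ws ! k" if "i < n" for i
  proof -
    have "vs ! i \<in> set ws"
      using that eq lv nth_mem[of i vs] by simp
    then show ?thesis
      unfolding in_set_conv_nth lw by metis
  qed
  have "adjacency_matrix G vs = P vs ws * adjacency_matrix G ws * P ws vs"
  proof (rule eq_matI)
    fix i j
    assume "i < dim_row (P vs ws * adjacency_matrix G ws * P ws vs)"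
      "j < dim_col (P vs ws * adjacency_matrix G ws * P ws vs)"
    then have i: "i < n" and j: "j < n" by (auto simp: P_def)
    obtain a where a: "a < n" "vs ! i = ws ! a" using idx i by blast
    obtain b where b: "b < n" "vs ! j = ws ! b" using idx j by blast
    have ua: "vs ! i = ws ! l \<longleftrightarrow> l = a" if "l < n" for l
      unfolding a(2) using nth_eq_iff_index_eq[OF ws, of a l] that a(1) lw by auto
    have ub: "ws ! l = vs ! j \<longleftrightarrow> l = b" if "l < n" for l
      unfolding b(2) using nth_eq_iff_index_eq[OF ws, of l b] that b(1) lw by auto
    have row: "(P vs ws * adjacency_matrix G ws) $$ (i, l) = of_bool ((ws ! a, ws ! l) \<in> arcs_ends G)"
      if "l < n" for l
    proof -
      have "(P vs ws * adjacency_matrix G ws) $$ (i, l)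
          = (\<Sum>m = 0..<n. of_bool (vs ! i = ws ! m) * of_bool ((ws ! m, ws ! l) \<in> arcs_ends G))"
        using i that by (simp add: P_def adjacency_matrix_def lw scalar_prod_def)
      also have "\<dots> = (\<Sum>m = 0..<n. if m = a then of_bool ((ws ! a, ws ! l) \<in> arcs_ends G) else 0)"
        by (rule sum.cong) (auto simp: ua)
      finally show ?thesis using a(1) by simp
    qed
    have "(P vs ws * adjacency_matrix G ws * P ws vs) $$ (i, j)
        = (\<Sum>l = 0..<n. (P vs ws * adjacency_matrix G ws) $$ (i, l) * of_bool (ws ! l = vs ! j))"
      using i j by (simp add: P_def adjacency_matrix_def lw scalar_prod_def)
    also have "\<dots> = (\<Sum>l = 0..<n. if l = b then of_bool ((ws ! a, ws ! b) \<in> arcs_ends G) else 0)"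
      by (rule sum.cong) (auto simp: ub row)
    also have "\<dots> = adjacency_matrix G vs $$ (i, j)"
      using a b i j by (simp add: adjacency_matrix_def lv)
    finally show "adjacency_matrix G vs $$ (i, j)
        = (P vs ws * adjacency_matrix G ws * P ws vs) $$ (i, j)" ..
  qed (simp_all add: P_def adjacency_matrix_def lv)
  then show ?thesis
    using PP[of vs ws] PP[of ws vs] vs ws eq lv lw
    by (intro similar_matI[of _ _ "P vs ws" "P ws vs" n])
       (auto simp: P_def adjacency_matrix_def)
qed

lemma adjacency_eigenvalues_eq:
  assumes "distinct vs" and "set vs = verts G"
  shows "adjacency_eigenvalues G = proots (char_poly (adjacency_matrix G vs))"
proof -
  let ?ws = "SOME vs. distinct vs \<and> set vs = verts G"
  have "distinct ?ws \<and> set ?ws = verts G"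
    by (rule someI[of _ vs]) (use assms in simp)
  then have "similar_mat (adjacency_matrix G ?ws) (adjacency_matrix G vs)"
    using assms by (intro similar_adjacency_matrix) auto
  then show ?thesis
    by (simp add: adjacency_eigenvalues_def char_poly_similar)
qed

definition positive_energy :: "real \<Rightarrow> ('a, 'b) pre_digraph \<Rightarrow> real" where
  "positive_energy p G = (\<Sum>x\<in>#{#x \<in># adjacency_eigenvalues G. x > 0#}. \<bar>x\<bar> powr p)"

definition negative_energy :: "real \<Rightarrow> ('a, 'b) pre_digraph \<Rightarrow> real" where
  "negative_energy p G = (\<Sum>x\<in>#{#x \<in># adjacency_eigenvalues G. x < 0#}. \<bar>x\<bar> powr p)"

text \<open>
  In a symmetric digraph the strongly connected components are the connected components of the
  underlying undirected graph; an isolated vertex forms a component.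
\<close>

definition num_components :: "('a, 'b) pre_digraph \<Rightarrow> nat" where
  "num_components G = card (pre_digraph.sccs G)"

end

theory Submission
  imports Defs "HOL-Analysis.Function_Topology" "HOL-Analysis.Convex"
begin

text \<open>
  Everything rests on the case \<open>p = 2\<close>: the squares of the positive eigenvalues, and likewise
  those of the negative ones, add up to at least the number \<open>n\<close> of vertices minus the number
  \<open>\<kappa>\<close> of components.

  Let \<open>A = P - N\<close> be the decomposition of the adjacency matrix into its positive and negative
  parts, so that \<open>\<Sum>\<^sub>i\<^sub>j P\<^sub>i\<^sub>j\<^sup>2\<close> is the positive square energy. Let \<open>K\<close> be a positive
  semidefinite kernel on the vertices with diagonal 1, that is, the Gram matrix of unit vectors
  \<open>g\<^sub>i\<close>. By Schur's product theorem \<open>\<Sum>\<^sub>i\<^sub>j K\<^sub>i\<^sub>j N\<^sub>i\<^sub>j\<^sup>2 \<ge> 0\<close>, and therefore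
  \<open>\<Sum>\<^sub>i\<^sub>j P\<^sub>i\<^sub>j\<^sup>2 \<ge> \<Sum>\<^sub>i\<^sub>j (P\<^sub>i\<^sub>j\<^sup>2 - K\<^sub>i\<^sub>j N\<^sub>i\<^sub>j\<^sup>2)\<close>. Where \<open>i\<close> and \<open>j\<close> are not adjacent, \<open>P\<^sub>i\<^sub>j = N\<^sub>i\<^sub>j\<close> and
  the summand is nonnegative because \<open>K\<^sub>i\<^sub>j \<le> 1\<close>. Where they are adjacent, \<open>P\<^sub>i\<^sub>j = 1 + N\<^sub>i\<^sub>j\<close>, and
  the minimum of \<open>(1 + x)\<^sup>2 - K\<^sub>i\<^sub>j x\<^sup>2\<close> over all real \<open>x\<close> is \<open>1 - 1 / (1 - K\<^sub>i\<^sub>j)\<close>. Replacing \<open>A\<close> by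
  \<open>- A\<close> changes nothing, so both square energies are at least the sum of \<open>1 - 1 / (1 - K\<^sub>i\<^sub>j)\<close> over
  the ordered adjacent pairs. This sum is called the separation of \<open>K\<close>; it is large when adjacent
  vertices have vectors that point away from each other
  (lemma \<open>separation_le_positive_square_sum\<close>).

  It remains to find a kernel of separation at least \<open>n - 1\<close> on every connected graph
  (lemma \<open>linked_separating_kernel\<close>). For a tree the vectors \<open>\<plusminus>1\<close> given by a 2-colouring do, for a
  complete graph the vertices of a regular simplex; in both cases the separation is exactly
  \<open>n - 1\<close>. In general one uses induction on \<open>n\<close>. If there is a cut vertex, the two sides can be
  rotated so that their vectors at the cut vertex agree, and separation is additive
  (lemma \<open>separating_glue\<close>). Otherwise remove a vertex \<open>v\<close> of maximal degree \<open>d\<close> and take a kernel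
  of maximal separation on the connected rest. Tilt the vectors of the neighbours of \<open>v\<close> towards a
  new direction \<open>h\<close>, orthogonal to everything, so that their component along \<open>h\<close> becomes \<open>1 / d\<close>,
  and represent \<open>v\<close> by \<open>- h\<close>. The edges at \<open>v\<close> contribute \<open>2 d / (d + 1)\<close>. The loss on the edges that
  meet the neighbourhood is at most \<open>(d - 1) / (d + 1)\<close>: by the first order condition at the
  maximum, tilting the neighbours towards the vertices of a regular simplex in new dimensions does
  not increase the separation, and this inequality, together with the maximality of \<open>d\<close>, is
  precisely what bounds the loss (lemmas \<open>maximiser_neighbourhood_bound\<close> and
  \<open>separating_extend\<close>). The net gain is at least 1.

  For \<open>p \<le> 2\<close> the bound follows because the \<open>p\<close>-norm of a vector is a nonincreasing function of
  \<open>p\<close>. For \<open>p \<ge> 2\<close> one sums \<open>x\<^sup>p \<ge> p / 2 \<cdot> x\<^sup>2 - (p / 2 - 1)\<close> over the eigenvalues of one sign; there are at most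
  \<open>n - \<kappa>\<close> of these, because the quadratic form of \<open>A\<close> vanishes on the \<open>\<kappa>\<close>-dimensional coordinate
  space of an independent set that contains one vertex of every component.
\<close>

section \<open>Positive semidefinite kernels and correlation kernels\<close>

text \<open>
  Kernels are functions on all pairs, of which only the values on \<open>V\<close> matter; this makes restriction,
  extension by zero and reindexing possible without changing types.
\<close>

definition psd_on :: "'a set \<Rightarrow> ('a \<Rightarrow> 'a \<Rightarrow> real) \<Rightarrow> bool" where
  "psd_on V K \<longleftrightarrow> (\<forall>x. 0 \<le> (\<Sum>i\<in>V. \<Sum>j\<in>V. x i * x j * K i j))"

lemma psd_onI: "(\<And>x. 0 \<le> (\<Sum>i\<in>V. \<Sum>j\<in>V. x i * x j * K i j)) \<Longrightarrow> psd_on V K"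
  by (simp add: psd_on_def)

lemma psd_onD: "psd_on V K \<Longrightarrow> 0 \<le> (\<Sum>i\<in>V. \<Sum>j\<in>V. x i * x j * K i j)"
  by (simp add: psd_on_def)

lemma psd_on_cong:
  assumes "\<And>i j. i \<in> V \<Longrightarrow> j \<in> V \<Longrightarrow> K i j = L i j"
  shows "psd_on V K \<longleftrightarrow> psd_on V L"
  using assms by (simp add: psd_on_def)

lemma psd_on_add:
  assumes "psd_on V K" "psd_on V L"
  shows "psd_on V (\<lambda>i j. K i j + L i j)"
proof (rule psd_onI)
  fix x :: "'a \<Rightarrow> real"
  show "0 \<le> (\<Sum>i\<in>V. \<Sum>j\<in>V. x i * x j * (K i j + L i j))"
    using psd_onD[OF assms(1), of x] psd_onD[OF assms(2), of x]
    by (simp add: distrib_left sum.distrib)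
qed

lemma psd_on_congruence:
  assumes "psd_on V K"
  shows "psd_on V (\<lambda>i j. \<rho> i * \<rho> j * K i j)"
proof (rule psd_onI)
  fix x :: "'a \<Rightarrow> real"
  show "0 \<le> (\<Sum>i\<in>V. \<Sum>j\<in>V. x i * x j * (\<rho> i * \<rho> j * K i j))"
    using psd_onD[OF assms, of "\<lambda>i. x i * \<rho> i"] by (simp add: mult_ac)
qed

lemma psd_on_scale:
  assumes "psd_on V K" "0 \<le> c"
  shows "psd_on V (\<lambda>i j. c * K i j)"
  using psd_on_congruence[OF assms(1), of "\<lambda>_. sqrt c"] assms(2) by simp

lemma psd_on_rank_one: "psd_on V (\<lambda>i j. h i * h j)"
proof (rule psd_onI)
  fix x :: "'a \<Rightarrow> real"
  have "(\<Sum>i\<in>V. \<Sum>j\<in>V. x i * x j * (h i * h j)) = (\<Sum>i\<in>V. x i * h i)\<^sup>2"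
    by (simp add: power2_eq_square sum_product mult_ac)
  then show "0 \<le> (\<Sum>i\<in>V. \<Sum>j\<in>V. x i * x j * (h i * h j))" by simp
qed

lemma psd_on_support:
  assumes "finite V" "A \<subseteq> V" and psd: "psd_on A K"
    and zero: "\<And>i j. i \<in> V \<Longrightarrow> j \<in> V \<Longrightarrow> \<not> (i \<in> A \<and> j \<in> A) \<Longrightarrow> K i j = 0"
  shows "psd_on V K"
proof (rule psd_onI)
  fix x :: "'a \<Rightarrow> real"
  have "(\<Sum>i\<in>V. \<Sum>j\<in>V. x i * x j * K i j) = (\<Sum>i\<in>A. \<Sum>j\<in>V. x i * x j * K i j)"
    using assms by (intro sum.mono_neutral_right) (auto intro!: sum.neutral)
  also have "\<dots> = (\<Sum>i\<in>A. \<Sum>j\<in>A. x i * x j * K i j)"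
    using assms by (intro sum.cong refl sum.mono_neutral_right) auto
  finally show "0 \<le> (\<Sum>i\<in>V. \<Sum>j\<in>V. x i * x j * K i j)"
    using psd_onD[OF psd, of x] by simp
qed

lemma psd_on_subset:
  assumes "finite V" "A \<subseteq> V" "psd_on V K"
  shows "psd_on A K"
proof (rule psd_onI)
  fix x :: "'a \<Rightarrow> real"
  let ?y = "\<lambda>i. if i \<in> A then x i else 0"
  have "(\<Sum>i\<in>V. \<Sum>j\<in>V. ?y i * ?y j * K i j) = (\<Sum>i\<in>A. \<Sum>j\<in>V. ?y i * ?y j * K i j)"
    using assms by (intro sum.mono_neutral_right) (auto intro!: sum.neutral)
  also have "\<dots> = (\<Sum>i\<in>A. \<Sum>j\<in>A. ?y i * ?y j * K i j)"
    using assms by (intro sum.cong refl sum.mono_neutral_right) auto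
  finally show "0 \<le> (\<Sum>i\<in>A. \<Sum>j\<in>A. x i * x j * K i j)"
    using psd_onD[OF assms(3), of ?y] by (simp cong: sum.cong)
qed

definition correlation_on :: "'a set \<Rightarrow> ('a \<Rightarrow> 'a \<Rightarrow> real) \<Rightarrow> bool" where
  "correlation_on V K \<longleftrightarrow>
     (\<forall>i\<in>V. \<forall>j\<in>V. K i j = K j i) \<and> (\<forall>i\<in>V. K i i = 1) \<and> psd_on V K"

lemma correlation_onI:
  "(\<And>i j. i \<in> V \<Longrightarrow> j \<in> V \<Longrightarrow> K i j = K j i) \<Longrightarrow> (\<And>i. i \<in> V \<Longrightarrow> K i i = 1) \<Longrightarrow> psd_on V K \<Longrightarrow>
    correlation_on V K"
  by (auto simp: correlation_on_def)

lemma correlation_on_sym: "correlation_on V K \<Longrightarrow> i \<in> V \<Longrightarrow> j \<in> V \<Longrightarrow> K i j = K j i"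
  by (auto simp: correlation_on_def)

lemma correlation_on_diag: "correlation_on V K \<Longrightarrow> i \<in> V \<Longrightarrow> K i i = 1"
  by (auto simp: correlation_on_def)

lemma correlation_on_psd: "correlation_on V K \<Longrightarrow> psd_on V K"
  by (auto simp: correlation_on_def)

lemma correlation_on_cong:
  assumes "\<And>i j. i \<in> V \<Longrightarrow> j \<in> V \<Longrightarrow> K i j = L i j"
  shows "correlation_on V K \<longleftrightarrow> correlation_on V L"
  using psd_on_cong[OF assms, of V] assms by (simp add: correlation_on_def)

lemma correlation_on_bounds:
  assumes fin: "finite V" and K: "correlation_on V K" and ij: "i \<in> V" "j \<in> V"
  shows "K i j \<le> 1" "- 1 \<le> K i j"
proof -
  have *: "0 \<le> 1 + s * s + 2 * s * K i j" if "i \<noteq> j" for s :: real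
  proof -
    have "psd_on {i, j} K"
      using psd_on_subset[OF fin _ correlation_on_psd[OF K], of "{i, j}"] ij by auto
    from psd_onD[OF this, of "\<lambda>k. if k = i then 1 else s"]
    show ?thesis
      using that correlation_on_diag[OF K ij(1)] correlation_on_diag[OF K ij(2)]
        correlation_on_sym[OF K ij] by (simp add: algebra_simps)
  qed
  show "K i j \<le> 1" "- 1 \<le> K i j"
    using *[of "-1"] *[of 1] correlation_on_diag[OF K ij(1)] by (cases "i = j"; simp)+
qed

lemma correlation_on_mix:
  assumes "correlation_on V K" "correlation_on V L" "0 \<le> s" "s \<le> 1"
  shows "correlation_on V (\<lambda>i j. (1 - s) * K i j + s * L i j)"
  using assms psd_on_add[OF psd_on_scale[of V K "1 - s"] psd_on_scale[of V L s]]
  by (auto simp: correlation_on_def)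

lemma correlation_on_identity: "correlation_on V (\<lambda>i j. if i = j then 1 else 0)"
  if "finite V"
proof (rule correlation_onI)
  show "psd_on V (\<lambda>i j. if i = j then 1 else 0)"
  proof (rule psd_onI)
    fix x :: "'a \<Rightarrow> real"
    have "(\<Sum>i\<in>V. \<Sum>j\<in>V. x i * x j * (if i = j then 1 else 0)) = (\<Sum>i\<in>V. x i * x i)"
      using that by (simp add: if_distrib cong: if_cong)
    then show "0 \<le> (\<Sum>i\<in>V. \<Sum>j\<in>V. x i * x j * (if i = j then 1 else 0))"
      by (simp add: sum_nonneg)
  qed
qed auto

text \<open>
  If \<open>K\<close> is the Gram matrix of unit vectors, this is the Gram matrix of their projections onto the
  orthogonal complement of the vector at \<open>v\<close>.
\<close>

lemma psd_on_schur_complement: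
  assumes fin: "finite V" and K: "correlation_on V K" and v: "v \<in> V"
  shows "psd_on V (\<lambda>i j. K i j - K i v * K v j)"
proof (rule psd_onI)
  fix x :: "'a \<Rightarrow> real"
  \<comment> \<open>Shifting the coefficient at \<open>v\<close> by \<open>c\<close> realises the projection.\<close>
  define c where "c = (\<Sum>i\<in>V. x i * K i v)"
  have c': "(\<Sum>i\<in>V. x i * K v i) = c"
    unfolding c_def using correlation_on_sym[OF K v] by (intro sum.cong) auto
  define y where "y i = x i - (if i = v then c else 0)" for i
  have row: "(\<Sum>j\<in>V. y i * y j * K i j) = y i * ((\<Sum>j\<in>V. x j * K i j) - c * K i v)" for i
  proof -
    have "(\<Sum>j\<in>V. y j * K i j) = (\<Sum>j\<in>V. x j * K i j - (if j = v then c * K i v else 0))"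
      by (rule sum.cong) (auto simp: y_def algebra_simps)
    also have "\<dots> = (\<Sum>j\<in>V. x j * K i j) - c * K i v"
      using fin v by (simp add: sum_subtractf)
    finally show ?thesis by (simp add: sum_distrib_left mult.assoc flip: sum_distrib_left)
  qed
  have "(\<Sum>i\<in>V. \<Sum>j\<in>V. y i * y j * K i j)
      = (\<Sum>i\<in>V. x i * ((\<Sum>j\<in>V. x j * K i j) - c * K i v)
           - (if i = v then c * ((\<Sum>j\<in>V. x j * K v j) - c * K v v) else 0))"
    unfolding row by (rule sum.cong) (auto simp: y_def algebra_simps)
  also have "\<dots> = (\<Sum>i\<in>V. x i * ((\<Sum>j\<in>V. x j * K i j) - c * K i v)) - c * (c - c)"
    using fin v c' correlation_on_diag[OF K v] by (simp add: sum_subtractf)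
  also have "\<dots> = (\<Sum>i\<in>V. \<Sum>j\<in>V. x i * x j * (K i j - K i v * K v j))"
    unfolding c'[symmetric]
    by (simp add: sum_distrib_left sum_distrib_right sum_subtractf algebra_simps)
  finally show "0 \<le> (\<Sum>i\<in>V. \<Sum>j\<in>V. x i * x j * (K i j - K i v * K v j))"
    using psd_onD[OF correlation_on_psd[OF K], of y] by simp
qed

section \<open>Sums over arcs and the separation of a kernel\<close>

definition arc_sum :: "('a \<Rightarrow> 'a \<Rightarrow> bool) \<Rightarrow> 'a set \<Rightarrow> 'a set \<Rightarrow> ('a \<Rightarrow> 'a \<Rightarrow> real) \<Rightarrow> real" where
  "arc_sum E A B f = (\<Sum>i\<in>A. \<Sum>j\<in>B. if E i j then f i j else 0)"

lemma arc_sum_cong: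
  assumes "\<And>i j. i \<in> A \<Longrightarrow> j \<in> B \<Longrightarrow> E i j \<Longrightarrow> f i j = g i j"
  shows "arc_sum E A B f = arc_sum E A B g"
  unfolding arc_sum_def using assms by (intro sum.cong) auto

lemma arc_sum_mono:
  assumes "\<And>i j. i \<in> A \<Longrightarrow> j \<in> B \<Longrightarrow> E i j \<Longrightarrow> f i j \<le> g i j"
  shows "arc_sum E A B f \<le> arc_sum E A B g"
  unfolding arc_sum_def using assms by (intro sum_mono) auto

lemma arc_sum_diff: "arc_sum E A B (\<lambda>i j. f i j - g i j) = arc_sum E A B f - arc_sum E A B g"
  unfolding arc_sum_def sum_subtractf[symmetric] by (intro sum.cong) auto

lemma arc_sum_cmult: "arc_sum E A B (\<lambda>i j. c * f i j) = c * arc_sum E A B f"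
  unfolding arc_sum_def sum_distrib_left by (intro sum.cong) auto

lemma arc_sum_zero: "(\<And>i j. i \<in> A \<Longrightarrow> j \<in> B \<Longrightarrow> \<not> E i j) \<Longrightarrow> arc_sum E A B f = 0"
  unfolding arc_sum_def by (intro sum.neutral ballI) auto

lemma arc_sum_nonneg: "(\<And>i j. i \<in> A \<Longrightarrow> j \<in> B \<Longrightarrow> E i j \<Longrightarrow> 0 \<le> f i j) \<Longrightarrow> 0 \<le> arc_sum E A B f"
  unfolding arc_sum_def by (intro sum_nonneg) auto

lemma arc_sum_swap:
  assumes "\<And>i j. E i j \<Longrightarrow> E j i" "\<And>i j. i \<in> A \<Longrightarrow> j \<in> B \<Longrightarrow> f j i = f i j"
  shows "arc_sum E B A f = arc_sum E A B f"
  unfolding arc_sum_def using assms by (subst sum.swap) (intro sum.cong refl, auto)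

lemma arc_sum_union:
  assumes sym: "\<And>i j. E i j \<Longrightarrow> E j i" and fin: "finite A" "finite B" and disj: "A \<inter> B = {}"
    and f: "\<And>i j. i \<in> A \<Longrightarrow> j \<in> B \<Longrightarrow> f j i = f i j"
  shows "arc_sum E (A \<union> B) (A \<union> B) f = arc_sum E A A f + 2 * arc_sum E A B f + arc_sum E B B f"
proof -
  have "arc_sum E (A \<union> B) (A \<union> B) f
      = arc_sum E A A f + arc_sum E A B f + (arc_sum E B A f + arc_sum E B B f)"
    unfolding arc_sum_def using fin disj by (simp add: sum.union_disjoint sum.distrib)
  also have "arc_sum E B A f = arc_sum E A B f"
    using sym f by (rule arc_sum_swap)
  finally show ?thesis by simp
qed

lemma arc_sum_one:
  assumes "finite B"
  shows "arc_sum E A B (\<lambda>_ _. 1) = (\<Sum>i\<in>A. real (card {j \<in> B. E i j}))"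
  unfolding arc_sum_def using assms by (intro sum.cong) (auto simp: sum.If_cases Int_def)

text \<open>
  A kernel value 1 on an edge would make the summand of \<open>separation\<close> a division by zero, of value 1
  instead of \<open>- \<infinity>\<close>; \<open>separating\<close> excludes this.
\<close>

definition separating :: "('a \<Rightarrow> 'a \<Rightarrow> bool) \<Rightarrow> 'a set \<Rightarrow> ('a \<Rightarrow> 'a \<Rightarrow> real) \<Rightarrow> bool" where
  "separating E V K \<longleftrightarrow> correlation_on V K \<and> (\<forall>i\<in>V. \<forall>j\<in>V. E i j \<longrightarrow> K i j < 1)"

definition separation :: "('a \<Rightarrow> 'a \<Rightarrow> bool) \<Rightarrow> 'a set \<Rightarrow> ('a \<Rightarrow> 'a \<Rightarrow> real) \<Rightarrow> real" where
  "separation E V K = arc_sum E V V (\<lambda>i j. 1 - 1 / (1 - K i j))"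

lemma separatingD:
  assumes "separating E V K"
  shows "correlation_on V K" "i \<in> V \<Longrightarrow> j \<in> V \<Longrightarrow> E i j \<Longrightarrow> K i j < 1"
  using assms by (auto simp: separating_def)

lemma separation_cong:
  assumes "\<And>i j. i \<in> V \<Longrightarrow> j \<in> V \<Longrightarrow> K i j = L i j"
  shows "separation E V K = separation E V L"
  unfolding separation_def by (rule arc_sum_cong) (simp add: assms)

section \<open>Kernels of maximal separation\<close>

lemma closed_correlation_on:
  fixes V :: "'a set"
  assumes fin: "finite V"
  shows "closed {k :: 'a \<times> 'a \<Rightarrow> real. correlation_on V (\<lambda>i j. k (i, j))}"
proof -
  have c: "continuous_on UNIV (\<lambda>k :: 'a \<times> 'a \<Rightarrow> real. k p)" for p
    by (intro continuous_intros continuous_on_product_coordinates)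
  show ?thesis
    unfolding correlation_on_def psd_on_def
    by (intro closed_Collect_conj closed_Collect_all closed_Collect_le closed_Collect_eq closed_Collect_imp
          continuous_intros c open_Collect_const ballI | simp add: Ball_def)+
qed

lemma separation_eq: "separation E V K = arc_sum E V V (\<lambda>_ _. 1) - arc_sum E V V (\<lambda>i j. 1 / (1 - K i j))"
  unfolding separation_def by (rule arc_sum_diff)

text \<open>
  Separation is not continuous where a kernel value on an edge tends to 1, but there it tends to
  \<open>- \<infinity>\<close>. The kernels that are at least as good as a given one keep their edge values below some
  \<open>1 - 1 / T\<close>, and so form a compact set.
\<close>

lemma separating_maximiser:
  fixes E :: "'a \<Rightarrow> 'a \<Rightarrow> bool"
  assumes fin: "finite V" and ex: "separating E V K0"
  obtains K where "separating E V K" "\<And>L. separating E V L \<Longrightarrow> separation E V L \<le> separation E V K"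
proof -
  define cost where "cost K = arc_sum E V V (\<lambda>i j. 1 / (1 - K i j))" for K :: "'a \<Rightarrow> 'a \<Rightarrow> real"
  have pos: "0 \<le> 1 / (1 - K i j)" if "separating E V K" "i \<in> V" "j \<in> V" "E i j" for K i j
    using separatingD(2)[OF that] by simp
  have cost_nonneg: "0 \<le> cost K" if "separating E V K" for K
    unfolding cost_def by (rule arc_sum_nonneg) (rule pos[OF that])
  define T where "T = cost K0 + 1"
  have T: "0 < T" "1 \<le> T" using cost_nonneg[OF ex] by (auto simp: T_def)
  have edge_le: "1 / (1 - K i j) \<le> cost K" if "separating E V K" "i \<in> V" "j \<in> V" "E i j" for K i j
  proof -
    define f where "f i j = (if E i j then 1 / (1 - K i j) else 0)" for i j
    have f: "0 \<le> f i j" if "i \<in> V" "j \<in> V" for i j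
      unfolding f_def using pos[OF \<open>separating E V K\<close> that] by simp
    have "1 / (1 - K i j) = f i j" using that by (simp add: f_def)
    also have "\<dots> \<le> (\<Sum>j\<in>V. f i j)"
      using fin f \<open>i \<in> V\<close> \<open>j \<in> V\<close> by (intro member_le_sum) simp_all
    also have "\<dots> \<le> (\<Sum>i\<in>V. \<Sum>j\<in>V. f i j)"
      using fin f \<open>i \<in> V\<close> by (intro member_le_sum[where f = "\<lambda>i. \<Sum>j\<in>V. f i j"]) (simp_all add: sum_nonneg)
    finally show ?thesis by (simp add: cost_def arc_sum_def f_def)
  qed
  define C where "C = {k :: 'a \<times> 'a \<Rightarrow> real. correlation_on V (\<lambda>i j. k (i, j))}
      \<inter> {k. \<forall>i\<in>V. \<forall>j\<in>V. E i j \<longrightarrow> k (i, j) \<le> 1 - 1 / T} \<inter> Pi\<^sub>E UNIV (\<lambda>_. {- 1..1})"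
  have c: "continuous_on X (\<lambda>k :: 'a \<times> 'a \<Rightarrow> real. k p)" for p X
    by (rule continuous_on_subset[OF continuous_on_product_coordinates]) simp
  have cmp: "compact (Pi\<^sub>E UNIV (\<lambda>_ :: 'a \<times> 'a. {- 1..1 :: real}))"
    using compactin_PiE[of "\<lambda>_ :: 'a \<times> 'a. euclidean :: real topology" UNIV "\<lambda>_. {- 1..1}"]
    by (simp add: euclidean_product_topology)
  have cl: "closed {k :: 'a \<times> 'a \<Rightarrow> real. \<forall>i\<in>V. \<forall>j\<in>V. E i j \<longrightarrow> k (i, j) \<le> 1 - 1 / T}"
    unfolding Ball_def
    by (intro closed_Collect_all closed_Collect_imp open_Collect_const closed_Collect_le c continuous_intros)
  have "compact C"
    unfolding C_def using closed_correlation_on[OF fin] cl cmp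
    by (intro closed_Int_compact closed_Int)
  have sepC: "separating E V (\<lambda>i j. k (i, j))" if "k \<in> C" for k
  proof -
    have "1 - 1 / T < 1" using T by simp
    moreover have "k (i, j) \<le> 1 - 1 / T" if "i \<in> V" "j \<in> V" "E i j" for i j
      using \<open>k \<in> C\<close> that by (simp add: C_def)
    ultimately have "k (i, j) < 1" if "i \<in> V" "j \<in> V" "E i j" for i j
      using that order.strict_trans1 by blast
    then show ?thesis using that by (simp add: C_def separating_def)
  qed
  have inC: "\<exists>k\<in>C. \<forall>i\<in>V. \<forall>j\<in>V. k (i, j) = L i j" if L: "separating E V L" and le: "cost L \<le> T" for L
  proof
    let ?k = "\<lambda>(i, j). if i \<in> V \<and> j \<in> V then L i j else 0"
    have "correlation_on V (\<lambda>i j. ?k (i, j)) \<longleftrightarrow> correlation_on V L"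
      by (rule correlation_on_cong) auto
    moreover have "L i j \<le> 1 - 1 / T" if "i \<in> V" "j \<in> V" "E i j" for i j
    proof -
      have "1 / (1 - L i j) \<le> T" using edge_le[OF L that] le by simp
      moreover have "0 < 1 - L i j" using separatingD(2)[OF L that] by simp
      ultimately show ?thesis using T by (simp add: field_simps)
    qed
    ultimately show "?k \<in> C"
      unfolding C_def using separatingD(1)[OF L] correlation_on_bounds[OF fin separatingD(1)[OF L]]
      by (auto simp: PiE_def extensional_def)
  qed auto
  have "C \<noteq> {}" using inC[OF ex] by (auto simp: T_def)
  have nz: "1 - k (i, j) \<noteq> 0" if "k \<in> C" "i \<in> V" "j \<in> V" "E i j" for k i j
    using separatingD(2)[OF sepC[OF that(1)] that(2-4)] by simp
  have "continuous_on C (\<lambda>k. separation E V (\<lambda>i j. k (i, j)))"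
    unfolding separation_def arc_sum_def
  proof (intro continuous_on_sum)
    fix i j assume ij: "i \<in> V" "j \<in> V"
    show "continuous_on C (\<lambda>k. if E i j then 1 - 1 / (1 - k (i, j)) else 0)"
    proof (cases "E i j")
      case True
      then have "continuous_on C (\<lambda>k. 1 - 1 / (1 - k (i, j)))"
        by (intro continuous_intros c ballI nz ij)
      with True show ?thesis by simp
    qed simp
  qed
  from continuous_attains_sup[OF \<open>compact C\<close> \<open>C \<noteq> {}\<close> this]
  obtain k where k: "k \<in> C"
    and mx: "\<And>l. l \<in> C \<Longrightarrow> separation E V (\<lambda>i j. l (i, j)) \<le> separation E V (\<lambda>i j. k (i, j))" by auto
  have small: "separation E V L \<le> separation E V (\<lambda>i j. k (i, j))" if "separating E V L" "cost L \<le> T" for L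
  proof -
    from inC[OF that] obtain l where l: "l \<in> C" "\<And>i j. i \<in> V \<Longrightarrow> j \<in> V \<Longrightarrow> l (i, j) = L i j" by auto
    have "separation E V L = separation E V (\<lambda>i j. l (i, j))"
      by (rule separation_cong) (simp add: l)
    with mx[OF l(1)] show ?thesis by simp
  qed
  show ?thesis
  proof
    show "separating E V (\<lambda>i j. k (i, j))" by (rule sepC[OF k])
    fix L assume L: "separating E V L"
    show "separation E V L \<le> separation E V (\<lambda>i j. k (i, j))"
    proof (cases "cost L \<le> T")
      case False
      then have "separation E V L \<le> separation E V K0"
        unfolding separation_eq cost_def[symmetric] by (simp add: T_def)
      also have "\<dots> \<le> separation E V (\<lambda>i j. k (i, j))"
        by (rule small[OF ex]) (simp add: T_def)
      finally show ?thesis .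
    qed (rule small[OF L])
  qed
qed

text \<open>
  The correlation kernels form a convex set, so a maximiser has nonpositive derivative in the
  direction of every other one.
\<close>

lemma maximiser_first_order:
  assumes fin: "finite V" and K: "separating E V K"
    and mx: "\<And>L. separating E V L \<Longrightarrow> separation E V L \<le> separation E V K"
    and L: "correlation_on V L"
  shows "0 \<le> arc_sum E V V (\<lambda>i j. (L i j - K i j) * (1 / (1 - K i j))\<^sup>2)"
proof (rule ccontr)
  assume neg: "\<not> ?thesis"
  define M where "M s i j = (1 - s) * K i j + s * L i j" for s i j
  have M: "separating E V (M s)" if "0 \<le> s" "s < 1" for s
  proof -
    have "M s i j < 1" if "i \<in> V" "j \<in> V" "E i j" for i j
    proof -
      have "s * L i j \<le> s * 1"
        using correlation_on_bounds(1)[OF fin L that(1,2)] \<open>0 \<le> s\<close> by (intro mult_left_mono)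
      moreover have "(1 - s) * K i j < (1 - s) * 1"
        using separatingD(2)[OF K that] \<open>s < 1\<close> by (intro mult_strict_left_mono) auto
      ultimately show ?thesis by (simp add: M_def)
    qed
    then show ?thesis
      unfolding separating_def M_def using correlation_on_mix[OF separatingD(1)[OF K] L] that by simp
  qed
  have M0: "M 0 i j = K i j" for i j by (simp add: M_def)
  have "((\<lambda>s. if E i j then 1 - 1 / (1 - M s i j) else 0) has_real_derivative
      (if E i j then - ((L i j - K i j) * (1 / (1 - K i j))\<^sup>2) else 0)) (at 0)"
    if "i \<in> V" "j \<in> V" for i j
  proof (cases "E i j")
    case True
    then have "1 - K i j \<noteq> 0" using separatingD(2)[OF K that] by simp
    then have "((\<lambda>s. 1 - 1 / (1 - M s i j)) has_real_derivative
        - ((L i j - K i j) * (1 / (1 - K i j))\<^sup>2)) (at 0)"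
      unfolding M_def by (auto intro!: derivative_eq_intros simp: power2_eq_square)
    with True show ?thesis by simp
  qed simp
  then have "((\<lambda>s. separation E V (M s)) has_real_derivative
      arc_sum E V V (\<lambda>i j. - ((L i j - K i j) * (1 / (1 - K i j))\<^sup>2))) (at 0)"
    unfolding separation_def arc_sum_def by (intro DERIV_sum) auto
  moreover have "0 < arc_sum E V V (\<lambda>i j. - ((L i j - K i j) * (1 / (1 - K i j))\<^sup>2))"
    using neg arc_sum_cmult[of E V V "- 1" "\<lambda>i j. (L i j - K i j) * (1 / (1 - K i j))\<^sup>2"]
    by (simp only: mult_minus1)
  ultimately obtain d where d: "0 < d"
      "\<And>h. 0 < h \<Longrightarrow> h < d \<Longrightarrow> separation E V (M 0) < separation E V (M h)"
    using DERIV_pos_inc_right[where f = "\<lambda>s. separation E V (M s)" and x = 0] by (metis (no_types, lifting) add_0)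
  define h where "h = min (d / 2) (1 / 2)"
  have h: "0 < h" "h < d" "h < 1" using d(1) by (auto simp: h_def)
  have "separation E V (M 0) = separation E V K"
    by (rule separation_cong) (simp add: M0)
  then show False using d(2)[OF h(1,2)] mx[OF M[of h]] h by simp
qed

section \<open>Gluing kernels\<close>

lemma separating_disjoint_union:
  assumes sym: "\<And>i j. E i j \<Longrightarrow> E j i"
    and fin: "finite A" "finite B" and disj: "A \<inter> B = {}"
    and none: "\<And>a b. a \<in> A \<Longrightarrow> b \<in> B \<Longrightarrow> \<not> E a b"
    and K: "separating E A K" and L: "separating E B L"
  obtains M where "separating E (A \<union> B) M"
    "separation E (A \<union> B) M = separation E A K + separation E B L"
proof
  note Kc = separatingD(1)[OF K] and Lc = separatingD(1)[OF L]
  define KA where "KA = (\<lambda>i j. if i \<in> A \<and> j \<in> A then K i j else 0)"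
  define LB where "LB = (\<lambda>i j. if i \<in> B \<and> j \<in> B then L i j else 0)"
  define M where "M = (\<lambda>i j. KA i j + LB i j)"
  have MA: "M i j = K i j" if "i \<in> A" "j \<in> A" for i j
    using that disj by (auto simp: M_def KA_def LB_def)
  have MB: "M i j = L i j" if "i \<in> B" "j \<in> B" for i j
    using that disj by (auto simp: M_def KA_def LB_def)
  have "psd_on A KA"
    using correlation_on_psd[OF Kc] by (subst psd_on_cong[of _ _ K]) (auto simp: KA_def)
  then have psdA: "psd_on (A \<union> B) KA"
    by (rule psd_on_support[rotated 2]) (use fin in \<open>auto simp: KA_def\<close>)
  have "psd_on B LB"
    using correlation_on_psd[OF Lc] by (subst psd_on_cong[of _ _ L]) (auto simp: LB_def)
  then have "psd_on (A \<union> B) LB"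
    by (rule psd_on_support[rotated 2]) (use fin in \<open>auto simp: LB_def\<close>)
  with psdA have "psd_on (A \<union> B) M" unfolding M_def by (rule psd_on_add)
  then have corr: "correlation_on (A \<union> B) M"
  proof (rule correlation_onI[rotated 2])
    show "M i j = M j i" for i j
      using correlation_on_sym[OF Kc, of i j] correlation_on_sym[OF Lc, of i j]
      by (simp add: M_def KA_def LB_def)
    show "M i i = 1" if "i \<in> A \<union> B" for i
      using that correlation_on_diag[OF Kc, of i] correlation_on_diag[OF Lc, of i] MA[of i i] MB[of i i] by auto
  qed
  have "M i j < 1" if "i \<in> A \<union> B" "j \<in> A \<union> B" "E i j" for i j
  proof -
    have "i \<in> A \<and> j \<in> A \<or> i \<in> B \<and> j \<in> B"
      using that none[of i j] none[of j i] sym[OF that(3)] by blast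
    then show ?thesis
      using that(3) MA[of i j] MB[of i j] separatingD(2)[OF K, of i j] separatingD(2)[OF L, of i j] by auto
  qed
  with corr show "separating E (A \<union> B) M" by (simp add: separating_def)
  have "separation E (A \<union> B) M = arc_sum E A A (\<lambda>i j. 1 - 1 / (1 - M i j))
      + 2 * arc_sum E A B (\<lambda>i j. 1 - 1 / (1 - M i j)) + arc_sum E B B (\<lambda>i j. 1 - 1 / (1 - M i j))"
    unfolding separation_def using sym fin disj correlation_on_sym[OF corr]
    by (intro arc_sum_union) auto
  also have "arc_sum E A B (\<lambda>i j. 1 - 1 / (1 - M i j)) = 0" using none by (rule arc_sum_zero)
  also have "arc_sum E A A (\<lambda>i j. 1 - 1 / (1 - M i j)) = separation E A K"
    unfolding separation_def by (rule arc_sum_cong) (simp add: MA)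
  also have "arc_sum E B B (\<lambda>i j. 1 - 1 / (1 - M i j)) = separation E B L"
    unfolding separation_def by (rule arc_sum_cong) (simp add: MB)
  finally show "separation E (A \<union> B) M = separation E A K + separation E B L" by simp
qed

text \<open>
  Connectedness in terms of cuts: no proper nonempty part of \<open>V\<close> is closed under adjacency. This form
  passes to the two sides of a cut vertex without any mention of paths.
\<close>

definition linked :: "('a \<Rightarrow> 'a \<Rightarrow> bool) \<Rightarrow> 'a set \<Rightarrow> bool" where
  "linked E V \<longleftrightarrow> (\<forall>A. A \<subseteq> V \<longrightarrow> A \<noteq> {} \<longrightarrow> A \<noteq> V \<longrightarrow> (\<exists>a\<in>A. \<exists>b\<in>V - A. E a b))"

lemma linkedD:
  "linked E V \<Longrightarrow> A \<subseteq> V \<Longrightarrow> A \<noteq> {} \<Longrightarrow> A \<noteq> V \<Longrightarrow> \<exists>a\<in>A. \<exists>b\<in>V - A. E a b"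
  by (auto simp: linked_def)

text \<open>
  A part \<open>X\<close> of one side may be assumed not to contain \<open>v\<close>, passing to the complement if necessary.
  The edge that leaves \<open>X\<close> in \<open>V\<close> then stays in the same side.
\<close>

lemma linked_split_at_cut_vertex:
  assumes sym: "\<And>i j. E i j \<Longrightarrow> E j i" and V: "linked E V" and v: "v \<in> V"
    and not: "\<not> linked E (V - {v})"
  obtains A B where "A \<noteq> {}" "B \<noteq> {}" "A \<inter> B = {}" "V = insert v (A \<union> B)" "v \<notin> A" "v \<notin> B"
    "\<And>a b. a \<in> A \<Longrightarrow> b \<in> B \<Longrightarrow> \<not> E a b" "linked E (insert v A)" "linked E (insert v B)"
proof -
  from not obtain A where A: "A \<subseteq> V - {v}" "A \<noteq> {}" "A \<noteq> V - {v}"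
    and none: "\<And>a b. a \<in> A \<Longrightarrow> b \<in> V - {v} - A \<Longrightarrow> \<not> E a b"
    unfolding linked_def by blast
  have side: "linked E (insert v C)"
    if C: "C \<subseteq> V - {v}" and sep: "\<And>a b. a \<in> C \<Longrightarrow> b \<in> V - {v} - C \<Longrightarrow> \<not> E a b" for C
  proof -
    have *: "\<exists>a\<in>X. \<exists>b\<in>insert v C - X. E a b" if X: "X \<subseteq> C" "X \<noteq> {}" for X
    proof -
      have "X \<subseteq> V" "X \<noteq> V" using X C v by auto
      from linkedD[OF V this(1) X(2) this(2)] obtain a b where "a \<in> X" "b \<in> V - X" "E a b" by blast
      moreover from this have "b \<in> insert v C" using sep[of a b] X by blast
      ultimately show ?thesis by blast
    qed
    show ?thesis
      unfolding linked_def
    proof (intro allI impI)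
      fix X assume X: "X \<subseteq> insert v C" "X \<noteq> {}" "X \<noteq> insert v C"
      show "\<exists>a\<in>X. \<exists>b\<in>insert v C - X. E a b"
      proof (cases "v \<in> X")
        case False
        then show ?thesis using *[of X] X by blast
      next
        case True
        have "\<exists>a\<in>insert v C - X. \<exists>b\<in>insert v C - (insert v C - X). E a b"
          using X True by (intro *) auto
        then show ?thesis using sym X(1) by blast
      qed
    qed
  qed
  show ?thesis
  proof (rule that[of A "V - {v} - A"])
    show "linked E (insert v A)" using A none by (intro side) auto
    show "linked E (insert v (V - {v} - A))" using A none sym by (intro side) blast+
  qed (use A v none in auto)
qed

text \<open>
  Both families of unit vectors can be placed in one space with a common vector at \<open>v\<close> and orthogonal
  complements of it otherwise. The inner product of \<open>g\<^sub>a\<close> and \<open>g\<^sub>b\<close> is then the product of their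
  inner products with the common vector.
\<close>

lemma separating_glue:
  assumes sym: "\<And>i j. E i j \<Longrightarrow> E j i" and irrefl: "\<And>i. \<not> E i i"
    and fin: "finite A" "finite B" and disj: "A \<inter> B = {}" "v \<notin> A" "v \<notin> B"
    and none: "\<And>a b. a \<in> A \<Longrightarrow> b \<in> B \<Longrightarrow> \<not> E a b"
    and K: "separating E (insert v A) K" and L: "separating E (insert v B) L"
  obtains M where "separating E (insert v (A \<union> B)) M"
    "separation E (insert v (A \<union> B)) M = separation E (insert v A) K + separation E (insert v B) L"
proof
  note Kc = separatingD(1)[OF K] and Lc = separatingD(1)[OF L]
  define V where "V = insert v (A \<union> B)"
  have finV: "finite V" using fin by (simp add: V_def)
  define h where "h i = (if i \<in> insert v A then K i v else L i v)" for i
  define M where "M i j = (if i \<in> insert v A \<and> j \<in> insert v A then K i j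
      else if i \<in> insert v B \<and> j \<in> insert v B then L i j else h i * h j)" for i j
  have Kv: "K v v = 1" and Lv: "L v v = 1"
    using correlation_on_diag[OF Kc] correlation_on_diag[OF Lc] by auto
  have MA: "M i j = K i j" if "i \<in> insert v A" "j \<in> insert v A" for i j
    using that by (simp add: M_def)
  have MB: "M i j = L i j" if "i \<in> insert v B" "j \<in> insert v B" for i j
    using that disj Kv Lv by (auto simp: M_def)
  define KA where "KA i j = (if i \<in> insert v A \<and> j \<in> insert v A then K i j - K i v * K v j else 0)" for i j
  define LB where "LB i j = (if i \<in> insert v B \<and> j \<in> insert v B then L i j - L i v * L v j else 0)" for i j
  have "psd_on (insert v A) KA"
    using psd_on_schur_complement[OF _ Kc, of v] fin
    by (subst psd_on_cong[of _ _ "\<lambda>i j. K i j - K i v * K v j"]) (auto simp: KA_def)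
  then have psdA: "psd_on V KA"
    by (rule psd_on_support[OF finV, rotated]) (auto simp: V_def KA_def)
  have "psd_on (insert v B) LB"
    using psd_on_schur_complement[OF _ Lc, of v] fin
    by (subst psd_on_cong[of _ _ "\<lambda>i j. L i j - L i v * L v j"]) (auto simp: LB_def)
  then have psdB: "psd_on V LB"
    by (rule psd_on_support[OF finV, rotated]) (auto simp: V_def LB_def)
  have hA: "h i = K i v" "K v i = K i v" if "i \<in> insert v A" for i
    using that correlation_on_sym[OF Kc, of v i] by (auto simp: h_def)
  have hB: "h i = L i v" "L v i = L i v" if "i \<in> insert v B" for i
    using that correlation_on_sym[OF Lc, of v i] disj Kv Lv by (auto simp: h_def)
  \<comment> \<open>The parts orthogonal to the common vector, and the rank one part along it.\<close>
  have split: "M i j = (KA i j + LB i j) + h i * h j" if "i \<in> V" "j \<in> V" for i j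
  proof -
    consider "i \<in> insert v A" "j \<in> insert v A" | "i \<in> insert v B" "j \<in> insert v B"
      | "i \<in> A" "j \<in> B" | "i \<in> B" "j \<in> A" using \<open>i \<in> V\<close> \<open>j \<in> V\<close> unfolding V_def by blast
    then show ?thesis
    proof cases
      case 1
      have "LB i j = 0"
        using 1 disj Lv correlation_on_sym[OF Lc] by (auto simp: LB_def)
      then show ?thesis using 1 hA[OF 1(1)] hA[OF 1(2)] MA[OF 1] by (simp add: KA_def)
    next
      case 2
      have "KA i j = 0"
        using 2 disj Kv correlation_on_sym[OF Kc] by (auto simp: KA_def)
      then show ?thesis using 2 hB[OF 2(1)] hB[OF 2(2)] MB[OF 2] by (simp add: LB_def)
    next
      case 3
      then have "i \<notin> insert v B" "j \<notin> insert v A" using disj by auto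
      then show ?thesis by (simp add: KA_def LB_def M_def)
    next
      case 4
      then have "i \<notin> insert v A" "j \<notin> insert v B" using disj by auto
      then show ?thesis by (simp add: KA_def LB_def M_def)
    qed
  qed
  have "psd_on V M"
    using psd_on_add[OF psd_on_add[OF psdA psdB] psd_on_rank_one[of V h]] split
    by (subst psd_on_cong[of _ _ "\<lambda>i j. (KA i j + LB i j) + h i * h j"]) auto
  then have corr: "correlation_on V M"
  proof (intro correlation_onI)
    fix i j assume "i \<in> V" "j \<in> V"
    then show "M i j = M j i"
      using correlation_on_sym[OF Kc] correlation_on_sym[OF Lc] by (simp add: M_def)
  next
    fix i assume "i \<in> V"
    then show "M i i = 1"
      using correlation_on_diag[OF Kc] correlation_on_diag[OF Lc] by (auto simp: M_def V_def)
  qed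
  have "M i j < 1" if "i \<in> V" "j \<in> V" "E i j" for i j
  proof -
    have "i \<in> insert v A \<and> j \<in> insert v A \<or> i \<in> insert v B \<and> j \<in> insert v B"
      using that none[of i j] none[of j i] sym[of i j] unfolding V_def by blast
    then show ?thesis
      using that(3) MA[of i j] MB[of i j] separatingD(2)[OF K, of i j] separatingD(2)[OF L, of i j] by auto
  qed
  with corr show "separating E (insert v (A \<union> B)) M" by (simp add: separating_def V_def)
  let ?f = "\<lambda>K i j. 1 - 1 / (1 - K i j) :: real"
  have sM: "?f M j i = ?f M i j" if "i \<in> V" "j \<in> V" for i j
    using correlation_on_sym[OF corr that] by simp
  have VV: "V = insert v A \<union> B" and dj: "insert v A \<inter> B = {}" using disj by (auto simp: V_def)
  have "separation E V M = arc_sum E (insert v A) (insert v A) (?f M)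
      + 2 * arc_sum E (insert v A) B (?f M) + arc_sum E B B (?f M)"
    unfolding separation_def VV using sym fin dj sM
    by (intro arc_sum_union) (auto simp: V_def)
  also have "arc_sum E (insert v A) B (?f M) = arc_sum E {v} B (?f M) + arc_sum E A B (?f M)"
    using fin disj by (simp add: arc_sum_def)
  also have "arc_sum E A B (?f M) = 0" using none by (rule arc_sum_zero)
  also have "arc_sum E (insert v A) (insert v A) (?f M) = separation E (insert v A) K"
    unfolding separation_def by (rule arc_sum_cong) (simp add: MA)
  also have "separation E (insert v A) K + 2 * (arc_sum E {v} B (?f M) + 0) + arc_sum E B B (?f M)
      = separation E (insert v A) K + (arc_sum E {v} {v} (?f M) + 2 * arc_sum E {v} B (?f M) + arc_sum E B B (?f M))"
    using irrefl by (simp add: arc_sum_def)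
  also have "arc_sum E {v} {v} (?f M) + 2 * arc_sum E {v} B (?f M) + arc_sum E B B (?f M)
      = arc_sum E ({v} \<union> B) ({v} \<union> B) (?f M)"
    using sym fin disj sM by (intro arc_sum_union[symmetric]) (auto simp: V_def)
  also have "\<dots> = separation E (insert v B) L"
    unfolding separation_def by (simp, rule arc_sum_cong) (simp add: MB)
  finally show "separation E (insert v (A \<union> B)) M
      = separation E (insert v A) K + separation E (insert v B) L" by (simp add: V_def)
qed

section \<open>Adding a vertex of maximal degree\<close>

text \<open>
  Multiplying the inner product on an edge by \<open>r\<close> is harmless compared with the effect of
  \<open>r\<^sup>2\<close> on the edges between two tilted vectors: the loss per ordered pair is at most an eighth of
  \<open>(1 - r\<^sup>2) / r\<^sup>2\<close>.
\<close>

lemma reciprocal_shrink_le: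
  fixes r k :: real
  assumes "0 \<le> r" "r < 1" "- 1 \<le> k" "k < 1"
  shows "8 * r\<^sup>2 * (1 / (1 - r * k) - 1 / (1 - k)) \<le> 1 - r\<^sup>2"
proof -
  define c where "c = - k"
  have c: "c \<le> 1" "- 1 < c" "k = - c" using assms by (auto simp: c_def)
  have rc: "0 < 1 + r * c"
  proof -
    have "- r \<le> r * c" using mult_left_mono[of "-1" c r] c assms by simp
    then show ?thesis using assms by simp
  qed
  have "8 * r\<^sup>2 * c \<le> (1 + r) * ((1 + r * c) * (1 + c))"
  proof (cases "0 \<le> c")
    case True
    have "4 * c \<le> (1 + c)\<^sup>2" using zero_le_power2[of "1 - c"] by (simp add: power2_eq_square algebra_simps)
    then have "4 * r * c \<le> r * (1 + c)\<^sup>2" using assms mult_left_mono[of "4 * c" "(1 + c)\<^sup>2" r] by simp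
    also have "\<dots> = (r + r * c) * (1 + c)" by (simp add: power2_eq_square algebra_simps)
    also have "\<dots> \<le> (1 + r * c) * (1 + c)" using assms c by (intro mult_right_mono) auto
    finally have *: "4 * r * c \<le> (1 + r * c) * (1 + c)" .
    have "8 * r\<^sup>2 * c = (2 * r) * (4 * r * c)" by (simp add: power2_eq_square)
    also have "\<dots> \<le> (1 + r) * (4 * r * c)"
      using assms True by (intro mult_right_mono) auto
    also have "\<dots> \<le> (1 + r) * ((1 + r * c) * (1 + c))"
      using assms * by (intro mult_left_mono) auto
    finally show ?thesis .
  next
    case False
    have "8 * r\<^sup>2 * c \<le> 0" using False by (simp add: mult_nonneg_nonpos)
    also have "0 \<le> (1 + r) * ((1 + r * c) * (1 + c))" using assms c rc by simp
    finally show ?thesis .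
  qed
  then have "(1 - r) * (8 * r\<^sup>2 * c) \<le> (1 - r) * ((1 + r) * ((1 + r * c) * (1 + c)))"
    using assms by (intro mult_left_mono) auto
  then have "8 * r\<^sup>2 * ((1 - r) * c) \<le> (1 - r\<^sup>2) * ((1 + r * c) * (1 + c))"
    by (simp add: power2_eq_square algebra_simps)
  then have "8 * r\<^sup>2 * ((1 - r) * c) / ((1 + r * c) * (1 + c)) \<le> 1 - r\<^sup>2"
    using rc c by (simp add: pos_divide_le_eq)
  moreover have "1 / (1 - r * k) - 1 / (1 - k) = ((1 - r) * c) / ((1 + r * c) * (1 + c))"
    using rc c diff_frac_eq[of "1 + r * c" "1 + c" 1 1] by (simp add: left_diff_distrib)
  ultimately show ?thesis by (simp only: times_divide_eq_right)
qed

text \<open>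
  Up to a factor, the Gram matrix of the vertices of a regular simplex centred at the origin.
\<close>

lemma psd_on_simplex:
  assumes fin: "finite S"
  shows "psd_on S (\<lambda>i j. (if i = j then real (card S) else 0) - 1)"
proof (rule psd_onI)
  fix x :: "'a \<Rightarrow> real"
  have "(\<Sum>i\<in>S. \<Sum>j\<in>S. x i * x j * ((if i = j then real (card S) else 0) - 1))
      = real (card S) * (\<Sum>i\<in>S. (x i)\<^sup>2) - (\<Sum>i\<in>S. x i)\<^sup>2"
  proof -
    have "(\<Sum>j\<in>S. x i * x j * ((if i = j then real (card S) else 0) - 1))
        = real (card S) * (x i)\<^sup>2 - x i * (\<Sum>j\<in>S. x j)" if "i \<in> S" for i
    proof -
      have "(\<Sum>j\<in>S. x i * x j * ((if i = j then real (card S) else 0) - 1))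
          = (\<Sum>j\<in>S. (if i = j then real (card S) * (x i)\<^sup>2 else 0) - x i * x j)"
        by (rule sum.cong) (auto simp: power2_eq_square algebra_simps)
      then show ?thesis using fin that by (simp add: sum_subtractf sum_distrib_left)
    qed
    then have "(\<Sum>i\<in>S. \<Sum>j\<in>S. x i * x j * ((if i = j then real (card S) else 0) - 1))
        = (\<Sum>i\<in>S. real (card S) * (x i)\<^sup>2 - x i * (\<Sum>j\<in>S. x j))"
      by (rule sum.cong[OF refl])
    also have "\<dots> = real (card S) * (\<Sum>i\<in>S. (x i)\<^sup>2) - (\<Sum>i\<in>S. x i) * (\<Sum>i\<in>S. x i)"
      unfolding sum_subtractf sum_distrib_left[symmetric] sum_distrib_right[symmetric] ..
    finally show ?thesis by (simp add: power2_eq_square)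
  qed
  moreover have "(\<Sum>i\<in>S. x i)\<^sup>2 \<le> real (card S) * (\<Sum>i\<in>S. (x i)\<^sup>2)"
    using sum_squared_le_sum_of_squares[of x S] by (simp add: mult.commute)
  ultimately show "0 \<le> (\<Sum>i\<in>S. \<Sum>j\<in>S. x i * x j * ((if i = j then real (card S) else 0) - 1))"
    by simp
qed

text \<open>
  The test kernel tilts the \<open>D + 1\<close> vectors of \<open>S\<close> by the same angle towards the vertices of a regular
  simplex in new dimensions, which have inner products \<open>- 1 / D\<close>. As the angle tends to zero, the
  first order condition becomes an inequality that is quadratic in the weights \<open>t\<close>. Its linearisation
  is sharp where \<open>t = D / (D + 1)\<close>, the value that \<open>t\<close> takes on a complete graph with \<open>D + 1\<close>
  vertices.
\<close>

lemma maximiser_neighbourhood_bound: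
  fixes E :: "'a \<Rightarrow> 'a \<Rightarrow> bool"
  assumes sym: "\<And>i j. E i j \<Longrightarrow> E j i" and irrefl: "\<And>i. \<not> E i i"
    and fin: "finite V" and S: "S \<subseteq> V" "card S = Suc D" "D \<noteq> 0"
    and K: "separating E V K"
    and mx: "\<And>L. separating E V L \<Longrightarrow> separation E V L \<le> separation E V K"
  defines "t \<equiv> \<lambda>i j. 1 / (1 - K i j)"
  shows "arc_sum E S S t \<le> D / Suc D * arc_sum E S S (\<lambda>_ _. 1) + arc_sum E S (V - S) (\<lambda>_ _. 1) / 4"
proof -
  note Kc = separatingD(1)[OF K]
  define R where "R = V - S"
  have VSR: "V = S \<union> R" "S \<inter> R = {}" and finS: "finite S" and finR: "finite R"
    using S fin finite_subset by (auto simp: R_def)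
  have D: "0 < real D" using S by simp
  have Ksym: "K j i = K i j" if "i \<in> V" "j \<in> V" for i j
    using correlation_on_sym[OF Kc that] by simp
  have ne: "1 - K i j \<noteq> 0" if "i \<in> V" "j \<in> V" "E i j" for i j
    using separatingD(2)[OF K that] by simp
  \<comment> \<open>\<open>r\<close> is the cosine of the angle. The condition is divided by \<open>1 - r\<close>, which leaves an affine
    function of \<open>r\<close>, so that its limit at \<open>r = 1\<close> is elementary.\<close>
  have test: "0 \<le> (1 + r) * arc_sum E S S (\<lambda>i j. (- 1 / D - K i j) * (t i j)\<^sup>2)
      + 2 * arc_sum E S R (\<lambda>i j. - K i j * (t i j)\<^sup>2)" if r: "0 \<le> r" "r < 1" for r :: real
  proof -
    define \<rho> where "\<rho> i = (if i \<in> S then r else 1)" for i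
    define H where "H i j = (if i \<in> S \<and> j \<in> S then (1 - r\<^sup>2) / D * ((if i = j then real (card S) else 0) - 1) else 0)" for i j
    define L where "L = (\<lambda>i j. \<rho> i * \<rho> j * K i j + H i j)"
    have r2: "r\<^sup>2 \<le> 1" using r by (simp add: power_le_one)
    have "psd_on S H"
      using psd_on_scale[OF psd_on_simplex[OF finS], of "(1 - r\<^sup>2) / D"] r2
      by (subst psd_on_cong[of _ _ "\<lambda>i j. (1 - r\<^sup>2) / D * ((if i = j then real (card S) else 0) - 1)"])
         (auto simp: H_def)
    then have "psd_on V H"
      by (rule psd_on_support[OF fin S(1)]) (auto simp: H_def)
    then have "psd_on V L"
      unfolding L_def by (rule psd_on_add[OF psd_on_congruence[OF correlation_on_psd[OF Kc]]])
    then have "correlation_on V L"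
    proof (intro correlation_onI)
      fix i j assume "i \<in> V" "j \<in> V"
      then show "L i j = L j i" using Ksym by (simp add: L_def H_def)
    next
      fix i assume "i \<in> V"
      then show "L i i = 1"
        using correlation_on_diag[OF Kc] D S(2)
        by (auto simp: L_def H_def \<rho>_def power2_eq_square field_simps)
    qed
    from maximiser_first_order[OF fin K mx this]
    have "0 \<le> arc_sum E V V (\<lambda>i j. (L i j - K i j) * (t i j)\<^sup>2)" by (simp add: t_def)
    also have "\<dots> = arc_sum E S S (\<lambda>i j. (L i j - K i j) * (t i j)\<^sup>2)
        + 2 * arc_sum E S R (\<lambda>i j. (L i j - K i j) * (t i j)\<^sup>2)
        + arc_sum E R R (\<lambda>i j. (L i j - K i j) * (t i j)\<^sup>2)"
      unfolding VSR(1) using sym finS finR VSR Ksym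
      by (intro arc_sum_union) (auto simp: L_def H_def t_def)
    also have "arc_sum E R R (\<lambda>i j. (L i j - K i j) * (t i j)\<^sup>2) = arc_sum E R R (\<lambda>i j. 0 * 0)"
      using VSR by (intro arc_sum_cong) (auto simp: L_def H_def \<rho>_def)
    also have "\<dots> = 0" by (simp add: arc_sum_def)
    also have "arc_sum E S S (\<lambda>i j. (L i j - K i j) * (t i j)\<^sup>2)
        = arc_sum E S S (\<lambda>i j. (1 - r) * ((1 + r) * ((- 1 / D - K i j) * (t i j)\<^sup>2)))"
    proof (rule arc_sum_cong)
      fix i j assume "i \<in> S" "j \<in> S" "E i j"
      moreover from this have "i \<noteq> j" using irrefl by auto
      ultimately show "(L i j - K i j) * (t i j)\<^sup>2 = (1 - r) * ((1 + r) * ((- 1 / D - K i j) * (t i j)\<^sup>2))"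
        by (simp add: L_def H_def \<rho>_def power2_eq_square algebra_simps diff_divide_distrib)
    qed
    also have "\<dots> = (1 - r) * ((1 + r) * arc_sum E S S (\<lambda>i j. (- 1 / D - K i j) * (t i j)\<^sup>2))"
      by (simp only: arc_sum_cmult)
    also have "arc_sum E S R (\<lambda>i j. (L i j - K i j) * (t i j)\<^sup>2)
        = arc_sum E S R (\<lambda>i j. (1 - r) * (- K i j * (t i j)\<^sup>2))"
      using VSR by (intro arc_sum_cong) (auto simp: L_def H_def \<rho>_def algebra_simps)
    also have "\<dots> = (1 - r) * arc_sum E S R (\<lambda>i j. - K i j * (t i j)\<^sup>2)"
      by (simp only: arc_sum_cmult)
    finally have "0 \<le> (1 - r) * ((1 + r) * arc_sum E S S (\<lambda>i j. (- 1 / D - K i j) * (t i j)\<^sup>2)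
      + 2 * arc_sum E S R (\<lambda>i j. - K i j * (t i j)\<^sup>2))" by (simp add: algebra_simps)
    then show ?thesis using r by (simp add: zero_le_mult_iff)
  qed
  define X where "X = arc_sum E S S (\<lambda>i j. (- 1 / D - K i j) * (t i j)\<^sup>2)"
  define Y where "Y = arc_sum E S R (\<lambda>i j. - K i j * (t i j)\<^sup>2)"
  have XY: "0 \<le> X + Y"
  proof (rule ccontr)
    assume neg: "\<not> ?thesis"
    \<comment> \<open>A value of \<open>r\<close> so close to 1 that \<open>(1 - r) * X\<close> cannot make up for the deficit.\<close>
    define r where "r = max 0 (1 - (- (X + Y)) / (\<bar>X\<bar> + 1))"
    have "0 \<le> r" "r < 1" using neg by (auto simp: r_def)
    define P where "P = (1 - r) * X"
    from test[OF \<open>0 \<le> r\<close> \<open>r < 1\<close>] have "0 \<le> 2 * (X + Y) - P"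
      by (simp add: P_def X_def Y_def algebra_simps)
    moreover have "\<bar>P\<bar> \<le> - (X + Y)"
    proof -
      have r1: "1 - r \<le> - (X + Y) / (\<bar>X\<bar> + 1)" by (simp add: r_def)
      have "\<bar>P\<bar> = (1 - r) * \<bar>X\<bar>" using \<open>r < 1\<close> by (simp add: P_def abs_mult)
      also have "\<dots> \<le> (1 - r) * (\<bar>X\<bar> + 1)" using \<open>r < 1\<close> by simp
      also have "\<dots> \<le> - (X + Y)" using r1 by (simp add: pos_le_divide_eq)
      finally show ?thesis .
    qed
    then have "- P \<le> - (X + Y)" by (rule abs_le_D2)
    ultimately show False using neg by simp
  qed
  have tK: "- K i j * (t i j)\<^sup>2 = t i j - (t i j)\<^sup>2" if "i \<in> V" "j \<in> V" "E i j" for i j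
  proof -
    have "t i j * (1 - K i j) = 1" using ne[OF that] by (simp add: t_def)
    then have "t i j * (t i j * (1 - K i j)) = t i j" by simp
    then show ?thesis by (simp add: power2_eq_square algebra_simps)
  qed
  have Yle: "Y \<le> arc_sum E S R (\<lambda>_ _. 1) / 4"
  proof -
    have "Y \<le> arc_sum E S R (\<lambda>i j. 1 / 4 * 1)"
      unfolding Y_def
    proof (rule arc_sum_mono)
      fix i j assume "i \<in> S" "j \<in> R" "E i j"
      then have "- K i j * (t i j)\<^sup>2 = t i j - (t i j)\<^sup>2" using VSR by (intro tK) auto
      also have "\<dots> \<le> 1 / 4 * 1" using zero_le_power2[of "t i j - 1 / 2"] by (simp add: power2_eq_square algebra_simps)
      finally show "- K i j * (t i j)\<^sup>2 \<le> 1 / 4 * 1" .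
    qed
    then show ?thesis unfolding arc_sum_cmult by simp
  qed
  have Xle: "X \<le> D / Suc D * arc_sum E S S (\<lambda>_ _. 1) - arc_sum E S S t"
  proof -
    have "X \<le> arc_sum E S S (\<lambda>i j. D / Suc D * 1 - t i j)"
      unfolding X_def
    proof (rule arc_sum_mono)
      fix i j assume "i \<in> S" "j \<in> S" "E i j"
      then have *: "- K i j * (t i j)\<^sup>2 = t i j - (t i j)\<^sup>2" using S by (intro tK) auto
      \<comment> \<open>The tangent of the parabola at \<open>t = D / (D + 1)\<close>.\<close>
      have "D / A + A / D * (t i j)\<^sup>2 - 2 * t i j = (A * t i j - D)\<^sup>2 / (A * D)" if "0 < A" for A :: real
        using D that by (simp add: field_simps power2_eq_square)
      from this[of "real (Suc D)"]
      have "0 \<le> D / Suc D + Suc D / D * (t i j)\<^sup>2 - 2 * t i j" by simp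
      moreover have "Suc D / D * (t i j)\<^sup>2 = (t i j)\<^sup>2 + (t i j)\<^sup>2 / D"
        using D by (simp add: field_simps)
      moreover have "(- 1 / D - K i j) * (t i j)\<^sup>2 = - ((t i j)\<^sup>2 / D) + - K i j * (t i j)\<^sup>2"
        by (simp add: algebra_simps)
      ultimately show "(- 1 / D - K i j) * (t i j)\<^sup>2 \<le> D / Suc D * 1 - t i j"
        using * by linarith
    qed
    then show ?thesis unfolding arc_sum_cmult arc_sum_diff .
  qed
  from XY Xle Yle show ?thesis by (simp add: R_def)
qed

text \<open>
  The neighbours of \<open>v\<close> are tilted so that their component along a new direction is \<open>e = 1 / d\<close>, and
  \<open>v\<close> is placed opposite to that direction. With \<open>r\<^sup>2 = 1 - e\<^sup>2\<close>, every value of \<open>1 - K\<close> inside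
  the neighbourhood shrinks by the factor \<open>r\<^sup>2\<close>, and \<open>(1 - r\<^sup>2) / r\<^sup>2 = 1 / (d\<^sup>2 - 1)\<close>.
\<close>

lemma separating_extend:
  fixes E :: "'a \<Rightarrow> 'a \<Rightarrow> bool"
  assumes sym: "\<And>i j. E i j \<Longrightarrow> E j i" and irrefl: "\<And>i. \<not> E i i"
    and fin: "finite V" and v: "v \<notin> V" and K: "separating E V K"
    and S: "S = {u \<in> V. E v u}" "card S = d" and d: "2 \<le> d"
  defines "t \<equiv> \<lambda>i j. 1 / (1 - K i j)"
  obtains M where "separating E (insert v V) M"
    "separation E (insert v V) M \<ge> separation E V K + 2 * real d / (real d + 1)
       - (arc_sum E S S t + arc_sum E S (V - S) (\<lambda>_ _. 1) / 4) / ((real d)\<^sup>2 - 1)"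
proof
  note Kc = separatingD(1)[OF K]
  define R where "R = V - S"
  have VSR: "V = S \<union> R" "S \<inter> R = {}" and finS: "finite S" and finR: "finite R"
    using S fin by (auto simp: R_def)
  define e where "e = 1 / real d"
  define r where "r = sqrt (1 - e\<^sup>2)"
  have e: "0 < e" "e < 1" using d by (auto simp: e_def)
  have e2: "e\<^sup>2 < 1" using e by (simp add: power_less_one_iff)
  have r: "0 < r" "r < 1" "r\<^sup>2 = 1 - e\<^sup>2" using e e2 by (auto simp: r_def)
  have dd: "1 < (real d)\<^sup>2" using d power_strict_mono[of 1 "real d" 2] by simp
  define \<kappa> where "\<kappa> = 1 / ((real d)\<^sup>2 - 1)"
  have \<kappa>: "(1 - r\<^sup>2) / r\<^sup>2 = \<kappa>" "0 < \<kappa>"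
  proof -
    have "e\<^sup>2 * (real d)\<^sup>2 = 1" using d by (simp add: e_def power_one_over)
    then have "1 - r\<^sup>2 = r\<^sup>2 * \<kappa>"
      using r(3) dd unfolding \<kappa>_def by (simp add: eq_divide_eq right_diff_distrib)
    then show "(1 - r\<^sup>2) / r\<^sup>2 = \<kappa>" using r(1) by simp
    show "0 < \<kappa>" using dd by (simp add: \<kappa>_def)
  qed
  have Ksym: "K j i = K i j" if "i \<in> V" "j \<in> V" for i j
    using correlation_on_sym[OF Kc that] by simp
  define \<rho> where "\<rho> i = (if i = v then 0 else if i \<in> S then r else 1)" for i
  define h where "h i = (if i = v then - 1 else if i \<in> S then e else 0)" for i
  define M where "M = (\<lambda>i j. \<rho> i * \<rho> j * K i j + h i * h j)"
  have MSS: "M i j = r\<^sup>2 * K i j + e\<^sup>2" if "i \<in> S" "j \<in> S" for i j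
    using that v S by (auto simp: M_def \<rho>_def h_def power2_eq_square)
  have MSR: "M i j = r * K i j" if "i \<in> S" "j \<in> R" for i j
    using that v S by (auto simp: M_def \<rho>_def h_def R_def)
  have MRR: "M i j = K i j" if "i \<in> R" "j \<in> R" for i j
    using that v S by (auto simp: M_def \<rho>_def h_def R_def)
  have MvS: "M v j = - e" if "j \<in> S" for j
    using that v S by (auto simp: M_def \<rho>_def h_def)
  have Msym: "M j i = M i j" if "i \<in> insert v V" "j \<in> insert v V" for i j
  proof (cases "i = v \<or> j = v")
    case True
    then show ?thesis by (auto simp: M_def \<rho>_def)
  next
    case False
    then show ?thesis using Ksym[of i j] that by (simp add: M_def mult.commute)
  qed
  have "psd_on (insert v V) (\<lambda>i j. \<rho> i * \<rho> j * K i j)"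
    by (rule psd_on_support[OF _ _ psd_on_congruence[OF correlation_on_psd[OF Kc]]])
      (use fin in \<open>auto simp: \<rho>_def\<close>)
  then have "psd_on (insert v V) M"
    unfolding M_def by (rule psd_on_add[OF _ psd_on_rank_one])
  then have corr: "correlation_on (insert v V) M"
  proof (intro correlation_onI)
    fix i assume "i \<in> insert v V"
    then consider "i = v" | "i \<in> S" | "i \<in> R" using VSR by blast
    then show "M i i = 1"
    proof cases
      case 1
      then show ?thesis by (simp add: M_def \<rho>_def h_def)
    next
      case 2
      then show ?thesis using MSS[OF 2 2] correlation_on_diag[OF Kc, of i] r(3) S by simp
    next
      case 3
      then show ?thesis using MRR[OF 3 3] correlation_on_diag[OF Kc, of i] by (simp add: R_def)
    qed
  qed (use Msym in auto)
  have inV: "i \<in> V" if "i \<in> S \<or> i \<in> R" for i using that VSR by auto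
  have tpos: "0 < 1 - K i j" if "i \<in> V" "j \<in> V" "E i j" for i j
    using separatingD(2)[OF K that] by simp
  have SSpos: "1 - M i j = r\<^sup>2 * (1 - K i j)" if "i \<in> S" "j \<in> S" for i j
    unfolding MSS[OF that] r(3) by (simp add: algebra_simps)
  have lt: "M i j < 1" if ij: "E i j" "i \<in> insert v V" "j \<in> insert v V" for i j
  proof -
    have SR: "M i j < 1" if "i \<in> S" "j \<in> R" for i j
    proof -
      have "r * K i j \<le> r * 1"
        using correlation_on_bounds(1)[OF fin Kc, of i j] inV that r(1) by (intro mult_left_mono) auto
      then show ?thesis using MSR[OF that] r(2) by simp
    qed
    have vS: "M v j < 1" if "E v j" "j \<in> V" for j
      using MvS[of j] that S e by simp
    have "i = v \<or> i \<in> S \<or> i \<in> R" "j = v \<or> j \<in> S \<or> j \<in> R" using ij(2,3) VSR(1) by auto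
    then consider "i = v" | "j = v" | "i \<in> S" "j \<in> S" | "i \<in> S" "j \<in> R"
      | "i \<in> R" "j \<in> S" | "i \<in> R" "j \<in> R" by blast
    then show ?thesis
    proof cases
      case 1
      then show ?thesis using vS[of j] ij irrefl[of v] by auto
    next
      case 2
      then show ?thesis using vS[of i] ij irrefl[of v] sym[OF ij(1)] Msym[of i j] by auto
    next
      case 3
      then have "0 < 1 - M i j" using SSpos[OF 3] tpos[of i j] ij inV r(1) by simp
      then show ?thesis by simp
    next
      case 4
      then show ?thesis by (rule SR)
    next
      case 5
      then show ?thesis using SR[of j i] Msym[of i j] ij by simp
    next
      case 6
      then show ?thesis using MRR[OF 6] separatingD(2)[OF K, of i j] inV ij by simp
    qed
  qed
  show "separating E (insert v V) M" using corr lt by (auto simp: separating_def)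
  let ?F = "\<lambda>i j. 1 - 1 / (1 - M i j)"
  have splitV: "arc_sum E V V f = arc_sum E S S f + 2 * arc_sum E S R f + arc_sum E R R f"
    if "\<And>i j. i \<in> V \<Longrightarrow> j \<in> V \<Longrightarrow> f j i = f i j" for f
    unfolding VSR(1) using sym finS finR VSR that by (intro arc_sum_union) auto
  have "separation E (insert v V) M = arc_sum E ({v} \<union> V) ({v} \<union> V) ?F" by (simp add: separation_def)
  also have "\<dots> = arc_sum E {v} {v} ?F + 2 * arc_sum E {v} V ?F + arc_sum E V V ?F"
    using sym fin v Msym by (intro arc_sum_union) auto
  also have "arc_sum E {v} {v} ?F = 0" using irrefl by (simp add: arc_sum_def)
  also have "arc_sum E {v} V ?F = arc_sum E {v} V (\<lambda>_ _. 1 / (real d + 1) * 1)"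
  proof (rule arc_sum_cong)
    fix i j assume "i \<in> {v}" "j \<in> V" "E i j"
    then have "M i j = - e" using MvS[of j] S by simp
    moreover have "1 - 1 / (1 + e) = 1 / (real d + 1)" using d by (simp add: e_def field_simps)
    ultimately show "?F i j = 1 / (real d + 1) * 1" by simp
  qed
  also have "\<dots> = real d / (real d + 1)"
    unfolding arc_sum_cmult arc_sum_one[OF fin] using S by simp
  also have "arc_sum E V V ?F = arc_sum E S S ?F + 2 * arc_sum E S R ?F + arc_sum E R R ?F"
    using Msym by (intro splitV) auto
  also have "arc_sum E S S ?F = arc_sum E S S (\<lambda>i j. (1 - t i j) - \<kappa> * t i j)"
  proof (rule arc_sum_cong)
    fix i j assume *: "i \<in> S" "j \<in> S" "E i j"
    then have "1 / (1 - M i j) = t i j / r\<^sup>2" by (simp add: SSpos t_def)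
    also have "\<dots> = t i j * (1 + (1 - r\<^sup>2) / r\<^sup>2)" using r(1) by (simp add: field_simps)
    finally show "?F i j = (1 - t i j) - \<kappa> * t i j" unfolding \<kappa>(1) by (simp add: algebra_simps)
  qed
  also have "\<dots> = arc_sum E S S (\<lambda>i j. 1 - t i j) - \<kappa> * arc_sum E S S t"
    by (simp only: arc_sum_diff arc_sum_cmult)
  also have "arc_sum E R R ?F = arc_sum E R R (\<lambda>i j. 1 - t i j)"
    by (rule arc_sum_cong) (simp add: MRR t_def)
  finally have eq: "separation E (insert v V) M = 0 + 2 * (real d / (real d + 1))
      + (arc_sum E S S (\<lambda>i j. 1 - t i j) - \<kappa> * arc_sum E S S t + 2 * arc_sum E S R ?F
         + arc_sum E R R (\<lambda>i j. 1 - t i j))" .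
  have "arc_sum E S R (\<lambda>i j. (1 - t i j) - \<kappa> / 8 * 1) \<le> arc_sum E S R ?F"
  proof (rule arc_sum_mono)
    fix i j assume *: "i \<in> S" "j \<in> R" "E i j"
    then have ij: "i \<in> V" "j \<in> V" by (auto simp: inV)
    have "8 * r\<^sup>2 * (1 / (1 - r * K i j) - 1 / (1 - K i j)) \<le> 1 - r\<^sup>2"
      using r separatingD(2)[OF K ij *(3)] correlation_on_bounds(2)[OF fin Kc ij]
      by (intro reciprocal_shrink_le) auto
    then have "1 / (1 - r * K i j) - 1 / (1 - K i j) \<le> (1 - r\<^sup>2) / r\<^sup>2 / 8"
      using r(1) by (simp add: field_simps)
    then show "(1 - t i j) - \<kappa> / 8 * 1 \<le> ?F i j"
      unfolding \<kappa>(1) using MSR[OF *(1,2)] by (simp add: t_def)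
  qed
  then have SR: "arc_sum E S R (\<lambda>i j. 1 - t i j) - \<kappa> / 8 * arc_sum E S R (\<lambda>_ _. 1) \<le> arc_sum E S R ?F"
    by (simp only: arc_sum_diff arc_sum_cmult)
  have sK: "separation E V K = arc_sum E S S (\<lambda>i j. 1 - t i j) + 2 * arc_sum E S R (\<lambda>i j. 1 - t i j)
      + arc_sum E R R (\<lambda>i j. 1 - t i j)"
    unfolding separation_def t_def using Ksym by (intro splitV) auto
  have "separation E V K + 2 * (real d / (real d + 1)) - \<kappa> * (arc_sum E S S t + arc_sum E S R (\<lambda>_ _. 1) / 4)
      \<le> separation E (insert v V) M"
    unfolding eq sK using SR by (simp add: algebra_simps)
  then show "separation E (insert v V) M \<ge> separation E V K + 2 * real d / (real d + 1)
       - (arc_sum E S S t + arc_sum E S (V - S) (\<lambda>_ _. 1) / 4) / ((real d)\<^sup>2 - 1)"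
    by (simp add: \<kappa>_def R_def)
qed

section \<open>Kernels on connected graphs and on unions of components\<close>

text \<open>
  In the inductive step without cut vertices, let \<open>a\<close> and \<open>b\<close> count the ordered adjacent pairs from the
  neighbourhood \<open>S\<close> of \<open>v\<close> into \<open>S\<close> and into the rest. A neighbour of \<open>v\<close> has degree at most \<open>d\<close>, one of
  its edges leading to \<open>v\<close>, whence \<open>a + b \<le> d (d - 1)\<close>. With the bound at the maximiser, the loss is at most
  \<open>(d - 1)\<^sup>2 / (d\<^sup>2 - 1) = (d - 1) / (d + 1)\<close>. For \<open>d = 1\<close> the denominators vanish, but then the graph
  is a single edge.
\<close>

lemma linked_separating_kernel:
  fixes E :: "'a \<Rightarrow> 'a \<Rightarrow> bool"
  assumes sym: "\<And>i j. E i j \<Longrightarrow> E j i" and irrefl: "\<And>i. \<not> E i i"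
    and "finite V" "V \<noteq> {}" "linked E V"
  shows "\<exists>K. separating E V K \<and> real (card V) - 1 \<le> separation E V K"
  using assms(3-)
proof (induction "card V" arbitrary: V rule: less_induct)
  case less
  note fin = \<open>finite V\<close>
  have triv: "separating E V K" if "correlation_on V K" "\<And>i j. i \<in> V \<Longrightarrow> j \<in> V \<Longrightarrow> E i j \<Longrightarrow> K i j < 1" for K
    using that by (auto simp: separating_def)
  consider (one) "card V = 1" | (cut) v where "v \<in> V" "\<not> linked E (V - {v})"
    | (whole) "card V \<noteq> 1" "\<And>v. v \<in> V \<Longrightarrow> linked E (V - {v})" by blast
  then show ?case
  proof cases
    case one
    then obtain v where V: "V = {v}" by (auto simp: card_1_singleton_iff)
    have "separating E V (\<lambda>i j. if i = j then 1 else 0)"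
      using correlation_on_identity[OF fin] irrefl V by (intro triv) auto
    moreover have "separation E V (\<lambda>i j. if i = j then 1 else 0) = 0"
      using irrefl V by (simp add: separation_def arc_sum_def)
    ultimately show ?thesis using one by fastforce
  next
    case cut
    from linked_split_at_cut_vertex[OF sym \<open>linked E V\<close> cut]
    obtain A B where AB: "A \<noteq> {}" "B \<noteq> {}" "A \<inter> B = {}" "V = insert v (A \<union> B)" "v \<notin> A" "v \<notin> B"
      "\<And>a b. a \<in> A \<Longrightarrow> b \<in> B \<Longrightarrow> \<not> E a b" "linked E (insert v A)" "linked E (insert v B)"
      by blast
    have finAB: "finite A" "finite B" using fin AB(4) by auto
    have card: "card V = 1 + card A + card B" "card (insert v A) = 1 + card A" "card (insert v B) = 1 + card B"
      using finAB AB by (auto simp: card_Un_disjoint)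
    have pos: "0 < card A" "0 < card B" using finAB AB by (auto simp: card_gt_0_iff)
    obtain K where K: "separating E (insert v A) K" "real (card (insert v A)) - 1 \<le> separation E (insert v A) K"
      using less.hyps[of "insert v A"] card pos finAB AB by auto
    obtain L where L: "separating E (insert v B) L" "real (card (insert v B)) - 1 \<le> separation E (insert v B) L"
      using less.hyps[of "insert v B"] card pos finAB AB by auto
    obtain M where "separating E (insert v (A \<union> B)) M"
      "separation E (insert v (A \<union> B)) M = separation E (insert v A) K + separation E (insert v B) L"
      by (rule separating_glue[OF sym irrefl finAB AB(3,5,6,7) K(1) L(1)])
    then show ?thesis
      using K(2) L(2) unfolding AB(4)[symmetric] card by (intro exI[of _ M]) simp
  next
    case whole
    define deg where "deg v = card {u \<in> V. E v u}" for v
    obtain v where v: "v \<in> V" and mx: "\<And>u. u \<in> V \<Longrightarrow> deg u \<le> deg v"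
    proof -
      have "Max (deg ` V) \<in> deg ` V" using fin \<open>V \<noteq> {}\<close> by (intro Max_in) auto
      then obtain v where "v \<in> V" "Max (deg ` V) = deg v" by auto
      moreover have "deg u \<le> Max (deg ` V)" if "u \<in> V" for u using fin that by (intro Max_ge) auto
      ultimately show ?thesis using that by simp
    qed
    define V' where "V' = V - {v}"
    have V: "V = insert v V'" "v \<notin> V'" "finite V'" using v fin by (auto simp: V'_def)
    have card: "card V = Suc (card V')" using V by simp
    have "V' \<noteq> {}" using whole(1) card by auto
    have "linked E V'" using whole(2)[OF v] by (simp add: V'_def)
    define S where "S = {u \<in> V'. E v u}"
    define d where "d = card S"
    have degv: "deg v = d" unfolding deg_def d_def S_def using irrefl V by (intro arg_cong[of _ _ card]) auto
    have finS: "finite S" and SV: "S \<subseteq> V'" using V by (auto simp: S_def)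
    have Sne: "S \<noteq> {}"
    proof -
      have "\<exists>a\<in>{v}. \<exists>b\<in>V - {v}. E a b"
        using \<open>V' \<noteq> {}\<close> V v by (intro linkedD[OF \<open>linked E V\<close>]) auto
      then show ?thesis by (auto simp: S_def V'_def)
    qed
    then have d0: "1 \<le> d" using finS by (simp add: d_def Suc_le_eq card_gt_0_iff)
    have row: "card {j \<in> S. E i j} + card {j \<in> V' - S. E i j} + 1 \<le> d" if i: "i \<in> S" for i
    proof -
      have iV: "i \<in> V" "E i v" using i V sym[of v i] by (auto simp: S_def)
      have "{u \<in> V. E i u} = insert v ({j \<in> S. E i j} \<union> {j \<in> V' - S. E i j})"
        using V SV iV by auto
      moreover have "v \<notin> {j \<in> S. E i j} \<union> {j \<in> V' - S. E i j}" using V SV by auto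
      ultimately have "deg i = Suc (card ({j \<in> S. E i j} \<union> {j \<in> V' - S. E i j}))"
        using V finS by (simp add: deg_def)
      also have "card ({j \<in> S. E i j} \<union> {j \<in> V' - S. E i j}) = card {j \<in> S. E i j} + card {j \<in> V' - S. E i j}"
        using V finS by (intro card_Un_disjoint) auto
      finally show ?thesis using mx[OF iV(1)] degv by simp
    qed
    show ?thesis
    proof (cases "d = 1")
      case True
      then obtain u where S1: "S = {u}" by (auto simp: d_def card_1_singleton_iff)
      have "{j \<in> V'. E u j} = {}"
      proof -
        have "card {j \<in> S. E u j} = 0" "card {j \<in> V' - S. E u j} = 0" using row[of u] S1 True by auto
        then show ?thesis using V finS by auto
      qed
      then have "V' = {u}"
        using linkedD[OF \<open>linked E V'\<close>, of "{u}"] S1 SV by auto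
      then have V2: "V = {v, u}" "u \<noteq> v" using V by auto
      define h where "h i = (if i = v then - 1 else 1 :: real)" for i
      have "u \<in> S" using S1 by simp
      then have uv: "E v u" "E u v" using sym[of v u] by (auto simp: S_def)
      have "separating E V (\<lambda>i j. h i * h j)"
        using irrefl by (intro triv correlation_onI psd_on_rank_one) (auto simp: h_def V2)
      moreover have "separation E V (\<lambda>i j. h i * h j) = 1"
        using V2 uv irrefl by (simp add: separation_def arc_sum_def h_def)
      ultimately show ?thesis using V2 by (intro exI[of _ "\<lambda>i j. h i * h j"]) simp
    next
      case False
      then have d: "2 \<le> d" using d0 by simp
      then obtain D where D: "d = Suc D" "D \<noteq> 0" by (cases d) auto
      obtain K0 where K0: "separating E V' K0" "real (card V') - 1 \<le> separation E V' K0"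
        using less.hyps[of V'] card V \<open>V' \<noteq> {}\<close> \<open>linked E V'\<close> by auto
      obtain K where K: "separating E V' K" and opt: "\<And>L. separating E V' L \<Longrightarrow> separation E V' L \<le> separation E V' K"
        using separating_maximiser[OF V(3) K0(1)] by blast
      define t where "t = (\<lambda>i j. 1 / (1 - K i j))"
      define a where "a = arc_sum E S S (\<lambda>_ _. 1)"
      define b where "b = arc_sum E S (V' - S) (\<lambda>_ _. 1)"
      have bound: "arc_sum E S S t \<le> D / Suc D * a + b / 4"
        unfolding t_def a_def b_def
        using D(1) d_def by (intro maximiser_neighbourhood_bound[OF sym irrefl V(3) SV _ D(2) K opt]) simp_all
      obtain M where M: "separating E (insert v V') M" and
        sM: "separation E (insert v V') M \<ge> separation E V' K + 2 * real d / (real d + 1)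
          - (arc_sum E S S t + b / 4) / ((real d)\<^sup>2 - 1)"
        unfolding t_def b_def
        by (rule separating_extend[OF sym irrefl V(3,2) K S_def d_def[symmetric] d])
      have b0: "0 \<le> b" unfolding b_def by (rule arc_sum_nonneg) simp
      have ab: "a + b \<le> real d * D"
      proof -
        have "a + b = (\<Sum>i\<in>S. real (card {j \<in> S. E i j} + card {j \<in> V' - S. E i j}))"
          unfolding a_def b_def using V finS by (simp add: arc_sum_one sum.distrib)
        also have "\<dots> \<le> (\<Sum>i\<in>S. real D)"
          using row D by (intro sum_mono) (simp del: of_nat_add)
        finally show ?thesis by (simp add: d_def)
      qed
      have half: "1 / 2 \<le> D / Suc D" using D(2) by (simp add: field_simps)
      have "arc_sum E S S t + b / 4 \<le> D / Suc D * a + 1 / 2 * b" using bound by simp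
      also have "\<dots> \<le> D / Suc D * a + D / Suc D * b"
        using mult_right_mono[OF half b0] by simp
      also have "\<dots> = D / Suc D * (a + b)" by (simp add: distrib_left)
      also have "\<dots> \<le> D / Suc D * (real d * D)" using ab by (intro mult_left_mono) auto
      also have "\<dots> = (real D)\<^sup>2" using D(1) by (simp add: power2_eq_square)
      finally have loss: "arc_sum E S S t + b / 4 \<le> (real D)\<^sup>2" by simp
      have dsq: "(real d)\<^sup>2 - 1 = D * (real d + 1)" using D(1) by (simp add: power2_eq_square algebra_simps)
      have "(arc_sum E S S t + b / 4) / ((real d)\<^sup>2 - 1) \<le> (real D)\<^sup>2 / (D * (real d + 1))"
        unfolding dsq using loss by (intro divide_right_mono) auto
      also have "\<dots> = D / (real d + 1)" using D(2) by (simp add: power2_eq_square)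
      finally have "(arc_sum E S S t + b / 4) / ((real d)\<^sup>2 - 1) \<le> D / (real d + 1)" .
      moreover have "2 * real d / (real d + 1) = 1 + D / (real d + 1)" using D(1) by (simp add: field_simps)
      ultimately have "separation E V' K + 1 \<le> separation E (insert v V') M" using sM by simp
      moreover have "real (card V') - 1 \<le> separation E V' K" using K0(2) opt[OF K0(1)] by simp
      ultimately show ?thesis using M card unfolding V(1)[symmetric] by (intro exI[of _ M]) simp
    qed
  qed
qed

lemma separating_kernel_of_components:
  fixes E :: "'a \<Rightarrow> 'a \<Rightarrow> bool"
  assumes sym: "\<And>i j. E i j \<Longrightarrow> E j i" and irrefl: "\<And>i. \<not> E i i"
    and "finite \<C>" and "\<And>C. C \<in> \<C> \<Longrightarrow> finite C \<and> C \<noteq> {} \<and> linked E C"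
    and "\<And>C D. C \<in> \<C> \<Longrightarrow> D \<in> \<C> \<Longrightarrow> C \<noteq> D \<Longrightarrow> C \<inter> D = {} \<and> (\<forall>a\<in>C. \<forall>b\<in>D. \<not> E a b)"
  shows "\<exists>K. separating E (\<Union>\<C>) K \<and> real (card (\<Union>\<C>)) - real (card \<C>) \<le> separation E (\<Union>\<C>) K"
  using assms(3-)
proof (induction \<C> rule: finite_induct)
  case empty
  show ?case by (simp add: separating_def correlation_on_def psd_on_def separation_def arc_sum_def)
next
  case (insert C \<C>)
  have C: "finite C" "C \<noteq> {}" "linked E C" using insert.prems(1) by auto
  have fin: "finite (\<Union>\<C>)" using insert.hyps insert.prems(1) by auto
  have ne: "D \<noteq> C" if "D \<in> \<C>" for D using that insert.hyps by auto
  have disj: "C \<inter> \<Union>\<C> = {}"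
  proof -
    have "C \<inter> D = {}" if "D \<in> \<C>" for D using insert.prems(2)[of C D] ne[OF that] that by auto
    then show ?thesis by auto
  qed
  have none: "\<not> E a b" if "a \<in> C" "b \<in> \<Union>\<C>" for a b
  proof -
    obtain D where "D \<in> \<C>" "b \<in> D" using \<open>b \<in> \<Union>\<C>\<close> by auto
    then show ?thesis using insert.prems(2)[of C D] ne[of D] \<open>a \<in> C\<close> by auto
  qed
  have "\<exists>K. separating E C K \<and> real (card C) - 1 \<le> separation E C K"
    by (rule linked_separating_kernel[OF _ irrefl C]) (rule sym)
  then obtain K where K: "separating E C K" "real (card C) - 1 \<le> separation E C K"
    by (elim exE conjE)
  have "\<exists>K. separating E (\<Union>\<C>) K \<and> real (card (\<Union>\<C>)) - real (card \<C>) \<le> separation E (\<Union>\<C>) K"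
  proof (rule insert.IH)
    show "finite D \<and> D \<noteq> {} \<and> linked E D" if "D \<in> \<C>" for D
      using insert.prems(1)[of D] that by simp
    show "D \<inter> D' = {} \<and> (\<forall>a\<in>D. \<forall>b\<in>D'. \<not> E a b)" if "D \<in> \<C>" "D' \<in> \<C>" "D \<noteq> D'" for D D'
      using insert.prems(2)[of D D'] that by simp
  qed
  then obtain L where L: "separating E (\<Union>\<C>) L"
      "real (card (\<Union>\<C>)) - real (card \<C>) \<le> separation E (\<Union>\<C>) L" by blast
  obtain M where M: "separating E (C \<union> \<Union>\<C>) M"
      "separation E (C \<union> \<Union>\<C>) M = separation E C K + separation E (\<Union>\<C>) L"
    by (rule separating_disjoint_union[OF sym C(1) fin disj none K(1) L(1)])
  have "card (C \<union> \<Union>\<C>) = card C + card (\<Union>\<C>)" using C(1) fin disj by (rule card_Un_disjoint)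
  then show ?case
    using M K(2) L(2) insert.hyps by (intro exI[of _ M]) simp
qed

section \<open>The spectral theorem for real symmetric matrices\<close>

text \<open>Filled up with zero rows, the matrix of the system is square and singular.\<close>

lemma underdetermined_system:
  fixes c :: "nat \<Rightarrow> nat \<Rightarrow> real"
  assumes "k < n"
  obtains x where "\<exists>i<n. x i \<noteq> 0" "\<And>l. l < k \<Longrightarrow> (\<Sum>i<n. c l i * x i) = 0"
proof -
  define M where "M = mat\<^sub>r n n (\<lambda>l. if l = k then 0\<^sub>v n else vec n (c l))"
  have M: "M \<in> carrier_mat n n" by (simp add: M_def)
  have "det M = 0"
    unfolding M_def by (rule det_row_0) (use assms in auto)
  then obtain v where v: "v \<in> carrier_vec n" "v \<noteq> 0\<^sub>v n" "M *\<^sub>v v = 0\<^sub>v n"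
    using det_0_iff_vec_prod_zero_field[OF M] by blast
  show ?thesis
  proof
    show "\<exists>i<n. v $ i \<noteq> 0"
      using v(1,2) by (auto simp: vec_eq_iff)
    fix l assume l: "l < k"
    then have "(M *\<^sub>v v) $ l = vec n (c l) \<bullet> v"
      using assms M by (simp add: M_def)
    also have "\<dots> = (\<Sum>i<n. c l i * v $ i)"
      using v(1) by (simp add: scalar_prod_def lessThan_atLeast0)
    finally show "(\<Sum>i<n. c l i * v $ i) = 0"
      using v(3) l assms by simp
  qed
qed

definition pairing :: "nat \<Rightarrow> (nat \<Rightarrow> real) \<Rightarrow> (nat \<Rightarrow> real) \<Rightarrow> real" where
  "pairing n x y = (\<Sum>i<n. x i * y i)"

lemma pairing_commute: "pairing n x y = pairing n y x"
  by (simp add: pairing_def mult.commute)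

lemma pairing_lincomb:
  "pairing n (\<lambda>i. x i + c * y i) z = pairing n x z + c * pairing n y z"
  "pairing n z (\<lambda>i. x i + c * y i) = pairing n z x + c * pairing n z y"
  by (simp_all add: pairing_def algebra_simps sum.distrib sum_distrib_left)

lemma pairing_self_nonneg: "0 \<le> pairing n x x"
  by (simp add: pairing_def sum_nonneg)

lemma pairing_self_eq_0: "pairing n x x = 0 \<longleftrightarrow> (\<forall>i<n. x i = 0)"
  by (auto simp: pairing_def sum_nonneg_eq_0_iff)

text \<open>
  The quadratic form of \<open>a\<close> attains its maximum on the unit vectors orthogonal to the eigenvectors
  found so far, and the maximiser is again an eigenvector: the residual \<open>a x - m x\<close> lies in that
  orthogonal space, and by the first variation it is orthogonal to it.
\<close>

lemma next_eigenfunction: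
  fixes a :: "nat \<Rightarrow> nat \<Rightarrow> real"
  assumes sym: "\<And>i j. i < n \<Longrightarrow> j < n \<Longrightarrow> a i j = a j i" and k: "k < n"
    and eig: "\<And>l i. l < k \<Longrightarrow> i < n \<Longrightarrow> (\<Sum>j<n. a i j * q l j) = e l * q l i"
  obtains x m where "pairing n x x = 1" "\<And>l. l < k \<Longrightarrow> pairing n (q l) x = 0"
    "\<And>i. i < n \<Longrightarrow> (\<Sum>j<n. a i j * x j) = m * x i"
proof -
  define A where "A x i = (\<Sum>j<n. a i j * x j)" for x i
  define Q where "Q x = pairing n x (A x)" for x
  define W where "W = {x. \<forall>l<k. pairing n (q l) x = 0}"
  define C where "C = Pi\<^sub>E UNIV (\<lambda>i. {- 1..1}) \<inter> W \<inter> {x. pairing n x x = 1}"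
  have c: "continuous_on X (\<lambda>x :: nat \<Rightarrow> real. x i)" for i X
    by (rule continuous_on_subset[OF continuous_on_product_coordinates]) simp
  have "compact (Pi\<^sub>E UNIV (\<lambda>_ :: nat. {- 1..1 :: real}))"
    using compactin_PiE[of "\<lambda>_ :: nat. euclidean :: real topology" UNIV "\<lambda>_. {- 1..1}"]
    by (simp add: euclidean_product_topology)
  moreover have "closed W"
    unfolding W_def pairing_def
    by (intro closed_Collect_all closed_Collect_imp open_Collect_const closed_Collect_eq
        continuous_intros c)
  moreover have "closed {x. pairing n x x = 1}"
    unfolding pairing_def by (intro closed_Collect_eq continuous_intros c)
  ultimately have "compact C" unfolding C_def by (intro compact_Int_closed)
  have normalise: "\<exists>y\<in>C. \<exists>s. pairing n x x = s\<^sup>2 \<and> (\<forall>i<n. x i = s * y i)"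
    if x: "x \<in> W" "\<exists>i<n. x i \<noteq> 0" for x
  proof
    define s where "s = sqrt (pairing n x x)"
    have s2: "pairing n x x = s\<^sup>2" by (simp add: s_def pairing_self_nonneg)
    have "pairing n x x \<noteq> 0" using x(2) by (auto simp: pairing_self_eq_0)
    then have s: "0 < s" using pairing_self_nonneg[of n x] by (simp add: s_def)
    define y where "y i = (if i < n then x i / s else 0)" for i
    have py: "pairing n z y = pairing n z x / s" for z
      unfolding pairing_def sum_divide_distrib by (rule sum.cong) (auto simp: y_def)
    have yy: "pairing n y y = 1"
      using s s2 by (simp add: py pairing_commute[of n y x] power2_eq_square)
    have "\<bar>y i\<bar> \<le> 1" for i
    proof (cases "i < n")
      case True
      then have "(y i)\<^sup>2 \<le> pairing n y y"
        unfolding pairing_def power2_eq_square by (intro member_le_sum) auto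
      then show ?thesis using yy by (simp add: abs_square_le_1)
    qed (simp add: y_def)
    then have "y \<in> Pi\<^sub>E UNIV (\<lambda>i. {- 1..1})" by (auto simp: abs_le_iff minus_le_iff)
    moreover have "y \<in> W" using x(1) by (simp add: W_def py)
    ultimately show "y \<in> C" using yy by (simp add: C_def)
    show "\<exists>s. pairing n x x = s\<^sup>2 \<and> (\<forall>i<n. x i = s * y i)"
      using s s2 by (intro exI[of _ s]) (simp add: y_def)
  qed
  obtain x0 where "\<exists>i<n. x0 i \<noteq> 0" "\<And>l. l < k \<Longrightarrow> (\<Sum>i<n. q l i * x0 i) = 0"
    using underdetermined_system[OF k, of q] by blast
  then have "C \<noteq> {}" using normalise[of x0] by (auto simp: W_def pairing_def)
  have Qexp: "Q x = (\<Sum>i<n. \<Sum>j<n. a i j * (x i * x j))" for x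
    by (simp add: Q_def A_def pairing_def sum_distrib_left mult_ac)
  have "continuous_on C Q"
    unfolding Qexp by (intro continuous_intros c)
  from continuous_attains_sup[OF \<open>compact C\<close> \<open>C \<noteq> {}\<close> this]
  obtain x where x: "x \<in> C" and mx: "\<And>y. y \<in> C \<Longrightarrow> Q y \<le> Q x" by blast
  define m where "m = Q x"
  have xW: "x \<in> W" and xx: "pairing n x x = 1" using x by (auto simp: C_def)
  have le: "Q y \<le> m * pairing n y y" if "y \<in> W" for y
  proof (cases "\<exists>i<n. y i \<noteq> 0")
    case True
    with normalise[OF that] obtain z s where z: "z \<in> C" "pairing n y y = s\<^sup>2" "\<forall>i<n. y i = s * z i" by blast
    have "Q y = s\<^sup>2 * Q z"
      using z(3) by (simp add: Qexp sum_distrib_left power2_eq_square mult_ac)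
    also have "\<dots> \<le> s\<^sup>2 * m" using mx[OF z(1)] by (simp add: m_def mult_left_mono)
    finally show ?thesis using z(2) by (simp add: mult.commute)
  next
    case False
    then show ?thesis by (simp add: Q_def pairing_def)
  qed
  have selfadj: "pairing n u (A w) = pairing n w (A u)" for u w
  proof -
    have "pairing n u (A w) = (\<Sum>i<n. \<Sum>j<n. a i j * (u i * w j))"
      by (simp add: A_def pairing_def sum_distrib_left mult_ac)
    also have "\<dots> = (\<Sum>j<n. \<Sum>i<n. a j i * (w j * u i))"
      by (subst sum.swap) (intro sum.cong refl, auto simp: sym)
    also have "\<dots> = pairing n w (A u)"
      by (simp add: A_def pairing_def sum_distrib_left mult_ac)
    finally show ?thesis .
  qed
  have Aadd: "A (\<lambda>i. u i + s * w i) = (\<lambda>i. A u i + s * A w i)" for u w s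
    by (rule ext) (simp add: A_def algebra_simps sum.distrib sum_distrib_left)
  have var: "pairing n y (A x) = m * pairing n y x" if y: "y \<in> W" for y
  proof -
    define b where "b = pairing n y (A x) - m * pairing n y x"
    define g where "g = m * pairing n y y - Q y"
    have g: "0 \<le> g" using le[OF y] by (simp add: g_def)
    have *: "2 * s * b \<le> s\<^sup>2 * g" for s
    proof -
      have "(\<lambda>i. x i + s * y i) \<in> W"
        using xW y by (simp add: W_def pairing_lincomb)
      from le[OF this] show ?thesis
        using xx selfadj[of x y] pairing_commute[of n x y] unfolding Q_def b_def g_def m_def
        by (simp add: Aadd pairing_lincomb power2_eq_square algebra_simps)
    qed
    have "b = 0"
    proof (rule ccontr)
      assume "b \<noteq> 0"
      define s where "s = b / (g + 1)"
      have b: "b = s * (g + 1)" using g by (simp add: s_def)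
      have "s\<^sup>2 * (g + 2) \<le> 0"
        using *[of s] by (simp add: b power2_eq_square algebra_simps)
      moreover have "0 < s\<^sup>2 * (g + 2)" using \<open>b \<noteq> 0\<close> b g by simp
      ultimately show False by simp
    qed
    then show ?thesis by (simp add: b_def)
  qed
  define z where "z i = A x i + (- m) * x i" for i
  have pz: "pairing n y z = pairing n y (A x) - m * pairing n y x" for y
    unfolding z_def by (simp add: pairing_def algebra_simps sum_subtractf sum_distrib_left)
  have "z \<in> W"
    unfolding W_def
  proof (intro CollectI allI impI)
    fix l assume l: "l < k"
    have "pairing n (q l) (A x) = pairing n x (A (q l))" by (rule selfadj)
    also have "\<dots> = pairing n x (\<lambda>i. e l * q l i)"
      unfolding pairing_def using eig[OF l] by (intro sum.cong) (auto simp: A_def)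
    also have "\<dots> = e l * pairing n (q l) x"
      by (simp add: pairing_def sum_distrib_left mult_ac)
    finally show "pairing n (q l) z = 0" using xW l by (simp add: pz W_def)
  qed
  then have "pairing n z z = 0" using var[of z] pz[of z] by simp
  then have "\<forall>i<n. A x i = m * x i" by (simp add: pairing_self_eq_0 z_def)
  then show ?thesis using that[OF xx, of m] xW by (simp add: A_def W_def)
qed

lemma spectral_theorem:
  fixes a :: "nat \<Rightarrow> nat \<Rightarrow> real"
  assumes sym: "\<And>i j. i < n \<Longrightarrow> j < n \<Longrightarrow> a i j = a j i"
  shows "\<exists>q e. (\<forall>k<n. \<forall>l<n. pairing n (q k) (q l) = (if k = l then 1 else 0)) \<and>
      (\<forall>k<n. \<forall>i<n. (\<Sum>j<n. a i j * q k j) = e k * q k i)"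
proof -
  have "\<exists>q e. (\<forall>k<N. \<forall>l<N. pairing n (q k) (q l) = (if k = l then 1 else 0)) \<and>
      (\<forall>k<N. \<forall>i<n. (\<Sum>j<n. a i j * q k j) = e k * q k i)" if "N \<le> n" for N
    using that
  proof (induction N)
    case (Suc N)
    then obtain q e where qe: "\<forall>k<N. \<forall>l<N. pairing n (q k) (q l) = (if k = l then 1 else 0)"
        "\<forall>k<N. \<forall>i<n. (\<Sum>j<n. a i j * q k j) = e k * q k i" by auto
    then have q: "\<And>k l. k < N \<Longrightarrow> l < N \<Longrightarrow> pairing n (q k) (q l) = (if k = l then 1 else 0)"
      and e: "\<And>k i. k < N \<Longrightarrow> i < n \<Longrightarrow> (\<Sum>j<n. a i j * q k j) = e k * q k i" by auto
    from Suc.prems have "N < n" by simp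
    have "\<exists>x m. pairing n x x = 1 \<and> (\<forall>l<N. pairing n (q l) x = 0) \<and>
        (\<forall>i<n. (\<Sum>j<n. a i j * x j) = m * x i)"
    proof (rule next_eigenfunction[of n a N q e])
      show "a i j = a j i" if "i < n" "j < n" for i j using that by (rule sym)
      show "N < n" by fact
      show "(\<Sum>j<n. a i j * q l j) = e l * q l i" if "l < N" "i < n" for l i using that by (rule e)
    next
      fix x m
      assume "pairing n x x = 1" "\<And>l. l < N \<Longrightarrow> pairing n (q l) x = 0"
        "\<And>i. i < n \<Longrightarrow> (\<Sum>j<n. a i j * x j) = m * x i"
      then show ?thesis by blast
    qed
    then obtain x m where x: "pairing n x x = 1" "\<And>l. l < N \<Longrightarrow> pairing n (q l) x = 0"
      "\<And>i. i < n \<Longrightarrow> (\<Sum>j<n. a i j * x j) = m * x i" by blast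
    have xq: "pairing n x (q l) = 0" if "l < N" for l
      using x(2)[OF that] pairing_commute[of n x "q l"] by simp
    have "\<forall>k<Suc N. \<forall>l<Suc N. pairing n ((q(N := x)) k) ((q(N := x)) l) = (if k = l then 1 else 0)"
      using q x(1,2) xq by (simp add: less_Suc_eq)
    moreover have "\<forall>k<Suc N. \<forall>i<n. (\<Sum>j<n. a i j * (q(N := x)) k j) = (e(N := m)) k * (q(N := x)) k i"
      using e x(3) by (simp add: less_Suc_eq)
    ultimately show ?case by (intro exI conjI)
  qed simp
  from this[OF order_refl] show ?thesis .
qed

text \<open>
  An orthonormal family of \<open>n\<close> eigenvectors diagonalises \<open>a\<close>, since a one-sided inverse of a square
  matrix is two-sided.
\<close>

lemma orthonormal_expansion:
  fixes a :: "nat \<Rightarrow> nat \<Rightarrow> real"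
  assumes orth: "\<And>k l. k < n \<Longrightarrow> l < n \<Longrightarrow> pairing n (q k) (q l) = (if k = l then 1 else 0)"
    and eig: "\<And>k i. k < n \<Longrightarrow> i < n \<Longrightarrow> (\<Sum>j<n. a i j * q k j) = e k * q k i"
  shows "i < n \<Longrightarrow> j < n \<Longrightarrow> a i j = (\<Sum>k<n. e k * (q k i * q k j))"
    and "proots (char_poly (mat n n (\<lambda>(i, j). a i j))) = image_mset e (mset_set {..<n})"
proof -
  define A where "A = mat n n (\<lambda>(i, j). a i j)"
  define U where "U = mat n n (\<lambda>(i, k). q k i)"
  define D where "D = mat n n (\<lambda>(k, l). if k = l then e k else 0)"
  define T where "T = mat n n (\<lambda>(k, i). q k i)"
  have car: "A \<in> carrier_mat n n" "U \<in> carrier_mat n n" "D \<in> carrier_mat n n" "T \<in> carrier_mat n n"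
    by (simp_all add: A_def U_def D_def T_def)
  have TU: "T * U = 1\<^sub>m n"
    by (rule eq_matI)
      (simp_all add: T_def U_def scalar_prod_def orth[unfolded pairing_def] flip: lessThan_atLeast0)
  have UT: "U * T = 1\<^sub>m n"
    using mat_mult_left_right_inverse[OF car(4,2) TU] .
  have UD: "(U * D) $$ (i, k) = e k * q k i" if "i < n" "k < n" for i k
  proof -
    have "(U * D) $$ (i, k) = (\<Sum>l<n. q l i * (if l = k then e l else 0))"
      using that by (simp add: U_def D_def scalar_prod_def lessThan_atLeast0)
    also have "\<dots> = (\<Sum>l<n. if l = k then e k * q k i else 0)"
      by (rule sum.cong) auto
    finally show ?thesis using that by simp
  qed
  have "A * U = U * D"
  proof (rule eq_matI)
    fix i k assume "i < dim_row (U * D)" "k < dim_col (U * D)"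
    then have ik: "i < n" "k < n" using car by auto
    have "(A * U) $$ (i, k) = (\<Sum>j<n. a i j * q k j)"
      using ik by (simp add: A_def U_def scalar_prod_def lessThan_atLeast0)
    then show "(A * U) $$ (i, k) = (U * D) $$ (i, k)"
      using eig[OF ik(2,1)] UD[OF ik] by simp
  qed (use car in auto)
  then have AUT: "A = U * D * T"
    using car UT by (metis assoc_mult_mat right_mult_one_mat)
  show "a i j = (\<Sum>k<n. e k * (q k i * q k j))" if "i < n" "j < n"
  proof -
    have "a i j = (U * D * T) $$ (i, j)" using that by (simp add: A_def flip: AUT)
    also have "\<dots> = (\<Sum>k<n. (U * D) $$ (i, k) * q k j)"
      using that car by (simp add: T_def scalar_prod_def lessThan_atLeast0)
    also have "\<dots> = (\<Sum>k<n. e k * (q k i * q k j))"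
      using that by (intro sum.cong) (auto simp: UD)
    finally show ?thesis .
  qed
  have "similar_mat A D"
    by (rule similar_matI[of _ _ U T n]) (use car UT TU AUT in auto)
  then have "char_poly A = char_poly D" by (rule char_poly_similar)
  also have "\<dots> = (\<Prod>x\<leftarrow>diag_mat D. [:- x, 1:])"
    by (rule char_poly_upper_triangular[OF car(3)]) (auto simp: D_def)
  also have "diag_mat D = map e [0..<n]"
    by (auto simp: diag_mat_def D_def)
  finally have "proots (char_poly A) = (\<Sum>p\<leftarrow>map (\<lambda>x. [:- x, 1:]) (map e [0..<n]). proots p)"
    using proots_prod_list[of "map (\<lambda>x. [:- x, 1:]) (map e [0..<n])"] by fastforce
  also have "\<dots> = mset (map e [0..<n])"
    by (induction n) auto
  also have "\<dots> = image_mset e (mset_set {..<n})"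
    by (simp add: lessThan_atLeast0)
  finally show "proots (char_poly (mat n n (\<lambda>(i, j). a i j))) = image_mset e (mset_set {..<n})"
    by (simp add: A_def)
qed

section \<open>Square energies dominate the separation\<close>

lemma psd_on_sum:
  assumes "\<And>k. k \<in> I \<Longrightarrow> psd_on V (K k)"
  shows "psd_on V (\<lambda>i j. \<Sum>k\<in>I. K k i j)"
  using assms
proof (induction I rule: infinite_finite_induct)
  case (insert k I)
  then show ?case using psd_on_add[of V "K k"] by simp
qed (simp_all add: psd_on_def)

text \<open>
  Schur's product theorem for a second factor that is given by its spectral decomposition, as a
  nonnegative combination of kernels of rank one.
\<close>

lemma psd_on_schur_product:
  assumes "psd_on V K" "\<And>k. k \<in> I \<Longrightarrow> 0 \<le> w k"
  shows "psd_on V (\<lambda>i j. K i j * (\<Sum>k\<in>I. w k * (f k i * f k j)))"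
proof -
  have "psd_on V (\<lambda>i j. \<Sum>k\<in>I. w k * (f k i * f k j * K i j))"
    using assms by (intro psd_on_sum psd_on_scale psd_on_congruence) auto
  then show ?thesis by (simp add: sum_distrib_left mult_ac)
qed

text \<open>
  The comparison between spectrum and separation. The sign \<open>c = \<plusminus>1\<close> serves to treat the positive and
  the negative eigenvalues of the adjacency matrix at the same time.
\<close>

lemma separation_le_positive_square_sum:
  fixes adj :: "nat \<Rightarrow> nat \<Rightarrow> bool"
  assumes orth: "\<And>k l. k < n \<Longrightarrow> l < n \<Longrightarrow> pairing n (q k) (q l) = (if k = l then 1 else 0)"
    and exp: "\<And>i j. i < n \<Longrightarrow> j < n \<Longrightarrow> c * of_bool (adj i j) = (\<Sum>k<n. e k * (q k i * q k j))"
    and c: "c\<^sup>2 = 1" and K: "separating adj {..<n} K"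
  shows "separation adj {..<n} K \<le> (\<Sum>k | k < n \<and> 0 < e k. (e k)\<^sup>2)"
proof -
  define P where "P i j = (\<Sum>k<n. max (e k) 0 * (q k i * q k j))" for i j
  define N where "N i j = (\<Sum>k<n. max (- e k) 0 * (q k i * q k j))" for i j
  have PN: "P i j = c * of_bool (adj i j) + N i j" if "i < n" "j < n" for i j
    unfolding P_def N_def exp[OF that] sum.distrib[symmetric]
    by (rule sum.cong) (auto simp: max_def algebra_simps)
  have "psd_on {..<n} (\<lambda>i j. K i j * N i j * N i j)"
    unfolding N_def using correlation_on_psd[OF separatingD(1)[OF K]]
    by (intro psd_on_schur_product) auto
  from psd_onD[OF this, of "\<lambda>_. 1"]
  have KN: "0 \<le> (\<Sum>i<n. \<Sum>j<n. K i j * (N i j)\<^sup>2)"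
    by (simp add: power2_eq_square mult.assoc)
  have le: "(if adj i j then 1 - 1 / (1 - K i j) else 0) \<le> (P i j)\<^sup>2 - K i j * (N i j)\<^sup>2"
    if "i < n" "j < n" for i j
  proof (cases "adj i j")
    case True
    define s where "s = 1 - K i j"
    have s: "0 < s" using separatingD(2)[OF K] True that by (simp add: s_def)
    \<comment> \<open>Completing the square in \<open>N i j\<close>.\<close>
    have "0 \<le> (s * N i j + c)\<^sup>2 / s" using s by simp
    also have "\<dots> = s * (N i j)\<^sup>2 + 2 * c * N i j + c\<^sup>2 / s"
      using s by (simp add: field_simps power2_eq_square)
    finally have "0 \<le> s * (N i j)\<^sup>2 + 2 * c * N i j + 1 / s" using c by simp
    moreover have "(P i j)\<^sup>2 - K i j * (N i j)\<^sup>2 = c\<^sup>2 + 2 * c * N i j + s * (N i j)\<^sup>2"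
      using PN[OF that] True by (simp add: s_def power2_eq_square algebra_simps)
    ultimately show ?thesis using c True by (simp add: s_def)
  next
    case False
    have "K i j \<le> 1"
      using correlation_on_bounds(1)[OF _ separatingD(1)[OF K]] that by simp
    then have "K i j * (N i j)\<^sup>2 \<le> 1 * (N i j)\<^sup>2" by (intro mult_right_mono) auto
    then show ?thesis using False PN[OF that] by simp
  qed
  have "separation adj {..<n} K \<le> (\<Sum>i<n. \<Sum>j<n. (P i j)\<^sup>2 - K i j * (N i j)\<^sup>2)"
    unfolding separation_def arc_sum_def using le by (intro sum_mono) auto
  also have "\<dots> \<le> (\<Sum>i<n. \<Sum>j<n. (P i j)\<^sup>2)"
    using KN by (simp add: sum_subtractf)
  also have "\<dots> = (\<Sum>i<n. \<Sum>j<n. \<Sum>k<n. \<Sum>l<n. (max (e k) 0 * max (e l) 0) * ((q k i * q l i) * (q k j * q l j)))"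
    unfolding P_def power2_eq_square sum_product by (intro sum.cong refl) (simp add: mult_ac)
  also have "\<dots> = (\<Sum>k<n. \<Sum>l<n. \<Sum>i<n. \<Sum>j<n. (max (e k) 0 * max (e l) 0) * ((q k i * q l i) * (q k j * q l j)))"
  proof -
    have "(\<Sum>i<n. \<Sum>j<n. \<Sum>k<n. \<Sum>l<n. F i j k l) = (\<Sum>k<n. \<Sum>l<n. \<Sum>i<n. \<Sum>j<n. F i j k l)"
      for F :: "nat \<Rightarrow> nat \<Rightarrow> nat \<Rightarrow> nat \<Rightarrow> real"
    proof -
      have "(\<Sum>i<n. \<Sum>j<n. \<Sum>k<n. \<Sum>l<n. F i j k l) = (\<Sum>i<n. \<Sum>k<n. \<Sum>j<n. \<Sum>l<n. F i j k l)"
        by (intro sum.cong refl sum.swap)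
      also have "\<dots> = (\<Sum>k<n. \<Sum>i<n. \<Sum>l<n. \<Sum>j<n. F i j k l)"
        by (subst sum.swap) (intro sum.cong refl sum.swap)
      also have "\<dots> = (\<Sum>k<n. \<Sum>l<n. \<Sum>i<n. \<Sum>j<n. F i j k l)"
        by (intro sum.cong refl sum.swap)
      finally show ?thesis .
    qed
    then show ?thesis .
  qed
  also have "\<dots> = (\<Sum>k<n. \<Sum>l<n. (max (e k) 0 * max (e l) 0) * (pairing n (q k) (q l) * pairing n (q k) (q l)))"
    unfolding pairing_def sum_product by (simp add: sum_distrib_left)
  also have "\<dots> = (\<Sum>k<n. \<Sum>l<n. if l = k then (max (e k) 0)\<^sup>2 else 0)"
    by (intro sum.cong refl) (auto simp: orth power2_eq_square)
  also have "\<dots> = (\<Sum>k<n. if 0 < e k then (e k)\<^sup>2 else 0)"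
    by (auto intro!: sum.cong)
  also have "\<dots> = (\<Sum>k | k < n \<and> 0 < e k. (e k)\<^sup>2)"
    by (simp add: sum.If_cases Int_def)
  finally show ?thesis .
qed

text \<open>
  The span of the eigenvectors with positive eigenvalue meets the coordinate space of \<open>I\<close> only in 0,
  because the form of \<open>a\<close> is positive definite on the former and zero on the latter.
\<close>

lemma card_positive_eigenvalues_le:
  fixes a :: "nat \<Rightarrow> nat \<Rightarrow> real"
  assumes orth: "\<And>k l. k < n \<Longrightarrow> l < n \<Longrightarrow> pairing n (q k) (q l) = (if k = l then 1 else 0)"
    and exp: "\<And>i j. i < n \<Longrightarrow> j < n \<Longrightarrow> a i j = (\<Sum>k<n. e k * (q k i * q k j))"
    and I: "I \<subseteq> {..<n}" and zero: "\<And>i j. i \<in> I \<Longrightarrow> j \<in> I \<Longrightarrow> a i j = 0"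
  shows "card {k. k < n \<and> 0 < e k} + card I \<le> n"
proof (rule ccontr)
  define T where "T = {k. k < n \<and> 0 < e k}"
  define J where "J = {..<n} - I"
  have fin: "finite T" "finite J" "finite I" using I finite_subset by (auto simp: T_def J_def)
  assume "\<not> ?thesis"
  moreover have "card J + card I = n"
    using I fin card_Diff_subset[of I "{..<n}"] card_mono[of "{..<n}" I] by (simp add: J_def)
  ultimately have lt: "card J < card T" by (simp add: T_def)
  obtain f g where f: "bij_betw f {0..<card T} T" and g: "bij_betw g {0..<card J} J"
    using ex_bij_betw_nat_finite fin by metis
  obtain y where y: "\<exists>m<card T. y m \<noteq> 0"
      "\<And>l. l < card J \<Longrightarrow> (\<Sum>m<card T. q (f m) (g l) * y m) = 0"
    using underdetermined_system[OF lt, of "\<lambda>l m. q (f m) (g l)"] by blast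
  have fT: "f m \<in> T" if "m < card T" for m using f that by (auto simp: bij_betw_def)
  define x where "x i = (\<Sum>m<card T. y m * q (f m) i)" for i
  have x0: "x i = 0" if "i \<in> J" for i
  proof -
    have "i \<in> g ` {0..<card J}" using bij_betw_imp_surj_on[OF g] that by simp
    then obtain l where "l < card J" "g l = i" by auto
    then show ?thesis using y(2)[of l] by (simp add: x_def mult.commute)
  qed
  have qx: "pairing n (q k) x = (\<Sum>m<card T. if f m = k then y m else 0)" if "k < n" for k
  proof -
    have "pairing n (q k) x = (\<Sum>m<card T. y m * pairing n (q k) (q (f m)))"
      unfolding pairing_def x_def sum_distrib_left
      by (subst sum.swap) (simp add: mult_ac)
    also have "\<dots> = (\<Sum>m<card T. if f m = k then y m else 0)"
      using fT that by (intro sum.cong) (auto simp: orth T_def)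
    finally show ?thesis .
  qed
  have "(\<Sum>i<n. \<Sum>j<n. x i * x j * a i j) = 0"
  proof (intro sum.neutral ballI)
    fix i j assume "i \<in> {..<n}" "j \<in> {..<n}"
    then show "x i * x j * a i j = 0"
      using x0[of i] x0[of j] zero[of i j] by (auto simp: J_def)
  qed
  moreover have "(\<Sum>i<n. \<Sum>j<n. x i * x j * a i j) = (\<Sum>k<n. e k * (pairing n (q k) x)\<^sup>2)"
  proof -
    have "(\<Sum>i<n. \<Sum>j<n. x i * x j * a i j)
        = (\<Sum>i<n. \<Sum>j<n. \<Sum>k<n. e k * ((q k i * x i) * (q k j * x j)))"
      by (intro sum.cong refl) (simp add: exp sum_distrib_left mult_ac)
    also have "\<dots> = (\<Sum>i<n. \<Sum>k<n. \<Sum>j<n. e k * ((q k i * x i) * (q k j * x j)))"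
      by (intro sum.cong refl sum.swap)
    also have "\<dots> = (\<Sum>k<n. \<Sum>i<n. \<Sum>j<n. e k * ((q k i * x i) * (q k j * x j)))"
      by (rule sum.swap)
    also have "\<dots> = (\<Sum>k<n. e k * (pairing n (q k) x)\<^sup>2)"
      unfolding pairing_def power2_eq_square sum_product by (simp add: sum_distrib_left)
    finally show ?thesis .
  qed
  ultimately have tot: "(\<Sum>k<n. e k * (pairing n (q k) x)\<^sup>2) = 0" by simp
  have nn: "0 \<le> e k * (pairing n (q k) x)\<^sup>2" if "k < n" for k
  proof (cases "k \<in> T")
    case False
    then have "pairing n (q k) x = 0" unfolding qx[OF that] using fT by (intro sum.neutral) auto
    then show ?thesis by simp
  qed (simp add: T_def)
  obtain m where m: "m < card T" "y m \<noteq> 0" using y(1) by blast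
  have fm: "f m < n" "0 < e (f m)" using fT[OF m(1)] by (auto simp: T_def)
  have "pairing n (q (f m)) x = (\<Sum>l<card T. if l = m then y l else 0)"
    unfolding qx[OF fm(1)] using f m(1) by (intro sum.cong) (auto simp: bij_betw_def inj_on_def)
  then have "pairing n (q (f m)) x = y m" using m(1) by simp
  moreover have "e (f m) * (pairing n (q (f m)) x)\<^sup>2 = 0"
    using sum_nonneg_0[OF _ _ tot, of "f m"] nn fm(1) by simp
  ultimately show False using m(2) fm(2) by simp
qed

section \<open>From squares to powers\<close>

text \<open>
  For \<open>p \<le> 2\<close>, normalise the sum of squares to 1; then \<open>x\<^sup>p \<ge> x\<^sup>2\<close> for every summand. For \<open>p \<ge> 2\<close>,
  Young's inequality gives \<open>x\<^sup>p \<ge> p / 2 \<cdot> x\<^sup>2 - (p / 2 - 1)\<close>, and the number of summands is at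
  most \<open>r\<close>.
\<close>

lemma power_sum_bounds:
  fixes x :: "'k \<Rightarrow> real"
  assumes fin: "finite T" and pos: "\<And>k. k \<in> T \<Longrightarrow> 0 < x k"
    and sq: "r \<le> (\<Sum>k\<in>T. (x k)\<^sup>2)" and card: "real (card T) \<le> r" and p: "0 < p"
  shows "p \<le> 2 \<Longrightarrow> r powr (p / 2) \<le> (\<Sum>k\<in>T. x k powr p)"
    and "2 \<le> p \<Longrightarrow> r \<le> (\<Sum>k\<in>T. x k powr p)"
proof -
  define s where "s = (\<Sum>k\<in>T. (x k)\<^sup>2)"
  have r0: "0 \<le> r" using card by (rule order_trans[rotated]) simp
  have pw: "x k powr p = (x k)\<^sup>2 powr (p / 2)" if "k \<in> T" for k
    using pos[OF that] by (simp add: powr_powr flip: powr_numeral)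
  show "r powr (p / 2) \<le> (\<Sum>k\<in>T. x k powr p)" if p2: "p \<le> 2"
  proof (cases "s = 0")
    case True
    then have "r = 0" using sq r0 by (simp add: s_def)
    then show ?thesis by (simp add: sum_nonneg)
  next
    case False
    then have s: "0 < s" unfolding s_def by (simp add: sum_nonneg order_less_le)
    have le: "s powr (p / 2) * ((x k)\<^sup>2 / s) \<le> x k powr p" if k: "k \<in> T" for k
    proof -
      have "(x k)\<^sup>2 \<le> s" unfolding s_def using fin k by (intro member_le_sum) auto
      then have "(x k)\<^sup>2 / s \<le> 1" using s by simp
      moreover have "0 < (x k)\<^sup>2 / s" using s pos[OF k] by simp
      ultimately have "((x k)\<^sup>2 / s) powr 1 \<le> ((x k)\<^sup>2 / s) powr (p / 2)"
        using p p2 by (intro powr_mono') auto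
      then have "(x k)\<^sup>2 / s \<le> (x k)\<^sup>2 powr (p / 2) / s powr (p / 2)"
        using s pos[OF k] by (simp add: powr_divide)
      then show ?thesis
        using s by (simp add: pw[OF k] pos_le_divide_eq mult.commute)
    qed
    have "r powr (p / 2) \<le> s powr (p / 2)"
      using sq r0 p by (intro powr_mono2) (auto simp: s_def)
    also have "\<dots> = (\<Sum>k\<in>T. s powr (p / 2) * ((x k)\<^sup>2 / s))"
      using s by (simp add: s_def flip: sum_distrib_left sum_divide_distrib)
    also have "\<dots> \<le> (\<Sum>k\<in>T. x k powr p)" by (rule sum_mono) (rule le)
    finally show ?thesis .
  qed
  show "r \<le> (\<Sum>k\<in>T. x k powr p)" if p2: "2 \<le> p"
  proof -
    have le: "p / 2 * (x k)\<^sup>2 - (p / 2 - 1) \<le> x k powr p" if k: "k \<in> T" for k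
    proof -
      have "(x k powr p) powr (2 / p) * 1 powr (1 - 2 / p) \<le> 2 / p * x k powr p + (1 - 2 / p) * 1"
        using p p2 pos[OF k] by (intro Youngs_inequality_0) auto
      moreover have "(x k powr p) powr (2 / p) = (x k)\<^sup>2"
        using p pos[OF k] by (simp add: powr_powr)
      ultimately have "(x k)\<^sup>2 \<le> 2 / p * x k powr p + (1 - 2 / p)" by simp
      then have "p / 2 * (x k)\<^sup>2 \<le> p / 2 * (2 / p * x k powr p + (1 - 2 / p))"
        using p by (intro mult_left_mono) auto
      also have "\<dots> = x k powr p + (p / 2 - 1)" using p by (simp add: field_simps)
      finally show ?thesis by simp
    qed
    have "r = p / 2 * r - (p / 2 - 1) * r" by (simp add: algebra_simps)
    also have "\<dots> \<le> p / 2 * s - (p / 2 - 1) * real (card T)"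
      using sq card p p2 by (intro diff_mono mult_left_mono) (auto simp: s_def)
    also have "\<dots> = (\<Sum>k\<in>T. p / 2 * (x k)\<^sup>2 - (p / 2 - 1))"
      by (simp add: s_def sum_subtractf sum_distrib_left)
    also have "\<dots> \<le> (\<Sum>k\<in>T. x k powr p)" by (rule sum_mono) (rule le)
    finally show ?thesis .
  qed
qed

section \<open>Components of a graph and the energy bounds\<close>

lemma separating_reindex:
  assumes f: "bij_betw f I V" and K: "separating E V K"
  shows "separating (\<lambda>i j. E (f i) (f j)) I (\<lambda>i j. K (f i) (f j))"
    and "separation (\<lambda>i j. E (f i) (f j)) I (\<lambda>i j. K (f i) (f j)) = separation E V K"
proof -
  have fV: "f i \<in> V" if "i \<in> I" for i using f that by (auto simp: bij_betw_def)
  have re: "(\<Sum>i\<in>I. \<Sum>j\<in>I. F (f i) (f j)) = (\<Sum>i\<in>V. \<Sum>j\<in>V. F i j)" for F :: "'b \<Rightarrow> 'b \<Rightarrow> real"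
  proof -
    have "(\<Sum>i\<in>I. \<Sum>j\<in>I. F (f i) (f j)) = (\<Sum>i\<in>I. \<Sum>j\<in>V. F (f i) j)"
      by (intro sum.cong refl sum.reindex_bij_betw[OF f])
    also have "\<dots> = (\<Sum>i\<in>V. \<Sum>j\<in>V. F i j)"
      by (rule sum.reindex_bij_betw[OF f])
    finally show ?thesis .
  qed
  have "psd_on I (\<lambda>i j. K (f i) (f j))"
  proof (rule psd_onI)
    fix x :: "'a \<Rightarrow> real"
    define y where "y v = x (inv_into I f v)" for v
    have y: "y (f i) = x i" if "i \<in> I" for i
      using f that by (simp add: y_def bij_betw_def)
    have "(\<Sum>i\<in>I. \<Sum>j\<in>I. x i * x j * K (f i) (f j)) = (\<Sum>i\<in>I. \<Sum>j\<in>I. y (f i) * y (f j) * K (f i) (f j))"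
      by (intro sum.cong refl) (simp add: y)
    also have "\<dots> = (\<Sum>i\<in>V. \<Sum>j\<in>V. y i * y j * K i j)" by (rule re)
    also have "0 \<le> \<dots>" by (rule psd_onD[OF correlation_on_psd[OF separatingD(1)[OF K]]])
    finally show "0 \<le> (\<Sum>i\<in>I. \<Sum>j\<in>I. x i * x j * K (f i) (f j))" .
  qed
  then show "separating (\<lambda>i j. E (f i) (f j)) I (\<lambda>i j. K (f i) (f j))"
    using K fV by (auto simp: separating_def correlation_on_def)
  show "separation (\<lambda>i j. E (f i) (f j)) I (\<lambda>i j. K (f i) (f j)) = separation E V K"
    unfolding separation_def arc_sum_def by (rule re)
qed

context graph begin

lemma sccs_verts_closed:
  assumes S: "S \<in> sccs_verts" and u: "u \<in> S" and uv: "(u, v) \<in> arcs_ends G"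
  shows "v \<in> S"
proof -
  have "u \<rightarrow>\<^sup>* v" using uv by (rule reachable_adjI)
  moreover from this have "v \<rightarrow>\<^sup>* u" by (rule symmetric_reachable')
  moreover have "\<forall>u\<in>S. \<forall>v. v \<notin> S \<longrightarrow> \<not> u \<rightarrow>\<^sup>* v \<or> \<not> v \<rightarrow>\<^sup>* u"
    using S by (simp add: in_sccs_verts_conv_reachable)
  ultimately show ?thesis using u by auto
qed

lemma sccs_verts_linked:
  assumes S: "S \<in> sccs_verts"
  shows "linked (\<lambda>u v. (u, v) \<in> arcs_ends G) S"
  unfolding linked_def
proof (intro allI impI)
  fix A assume A: "A \<subseteq> S" "A \<noteq> {}" "A \<noteq> S"
  obtain a b where ab: "a \<in> A" "b \<in> S" "b \<notin> A" using A by blast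
  have "a \<rightarrow>\<^sup>* b" using S A(1) ab by (auto simp: in_sccs_verts_conv_reachable)
  show "\<exists>a\<in>A. \<exists>b\<in>S - A. (a, b) \<in> arcs_ends G"
  proof (rule ccontr)
    assume none: "\<not> ?thesis"
    from \<open>a \<rightarrow>\<^sup>* b\<close> have "b \<in> A"
    proof (induction rule: reachable_induct)
      case base
      show ?case by (rule ab(1))
    next
      case (step x y)
      have "y \<in> S" using S _ step.hyps(2) by (rule sccs_verts_closed) (use A(1) step.IH in auto)
      then show ?case using none step.IH step.hyps(2) by auto
    qed
    with ab(3) show False by contradiction
  qed
qed

lemma sccs_verts_not_adjacent:
  assumes "S \<in> sccs_verts" "T \<in> sccs_verts" "S \<noteq> T" "u \<in> S" "v \<in> T"
  shows "(u, v) \<notin> arcs_ends G"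
  using sccs_verts_closed[OF assms(1,4)] sccs_verts_disjoint[OF assms(1-3)] assms(5) by auto

lemma Union_sccs_verts: "\<Union>sccs_verts = verts G"
proof
  show "\<Union>sccs_verts \<subseteq> verts G" using sccs_verts_subsets by auto
  show "verts G \<subseteq> \<Union>sccs_verts"
  proof
    fix u assume "u \<in> verts G"
    then show "u \<in> \<Union>sccs_verts"
      using scc_of_in_sccs_verts[of u] in_scc_of_self[of u] by auto
  qed
qed

lemma card_sccs_verts_num_components: "card sccs_verts = num_components G"
  unfolding num_components_def by (rule card_sccs_verts)

text \<open>One vertex of each component.\<close>

lemma independent_transversal:
  obtains I where "I \<subseteq> verts G" "card I = num_components G"
    "\<And>u v. u \<in> I \<Longrightarrow> v \<in> I \<Longrightarrow> (u, v) \<notin> arcs_ends G"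
proof
  define r where "r S = (SOME u. u \<in> S)" for S :: "'a set"
  have r: "r S \<in> S" if "S \<in> sccs_verts" for S
  proof -
    have "S \<noteq> {}" using that by (simp add: in_sccs_verts_conv_reachable)
    then show ?thesis unfolding r_def by (rule some_in_eq[THEN iffD2])
  qed
  show "r ` sccs_verts \<subseteq> verts G" using r sccs_verts_subsets by auto
  have "inj_on r sccs_verts"
  proof (rule inj_onI, rule ccontr)
    fix S T assume ST: "S \<in> sccs_verts" "T \<in> sccs_verts" "r S = r T" "S \<noteq> T"
    then show False using r[OF ST(1)] r[OF ST(2)] sccs_verts_disjoint[OF ST(1,2,4)] by auto
  qed
  then show "card (r ` sccs_verts) = num_components G"
    by (simp add: card_image card_sccs_verts_num_components)
  show "(u, v) \<notin> arcs_ends G" if uv: "u \<in> r ` sccs_verts" "v \<in> r ` sccs_verts" for u v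
  proof -
    obtain S T where ST: "S \<in> sccs_verts" "T \<in> sccs_verts" "u = r S" "v = r T" using uv by auto
    show ?thesis
    proof (cases "S = T")
      case True
      then show ?thesis using ST adj_not_same by auto
    next
      case False
      then show ?thesis using sccs_verts_not_adjacent[OF ST(1,2) False] r ST by simp
    qed
  qed
qed

lemma graph_separating_kernel:
  obtains K where "separating (\<lambda>u v. (u, v) \<in> arcs_ends G) (verts G) K"
    "real (card (verts G)) - real (num_components G)
       \<le> separation (\<lambda>u v. (u, v) \<in> arcs_ends G) (verts G) K"
proof -
  let ?E = "\<lambda>u v. (u, v) \<in> arcs_ends G"
  have "\<exists>K. separating ?E (\<Union>sccs_verts) K \<and>
      real (card (\<Union>sccs_verts)) - real (card sccs_verts) \<le> separation ?E (\<Union>sccs_verts) K"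
  proof (rule separating_kernel_of_components)
    show "?E v u" if "?E u v" for u v using sym_arcs that by (rule arcs_ends_symmetric)
    show "\<not> ?E u u" for u using adj_not_same by auto
    show "finite sccs_verts" by (rule finite_sccs_verts)
    show "finite S \<and> S \<noteq> {} \<and> linked ?E S" if "S \<in> sccs_verts" for S
      using that finite_subset[OF sccs_verts_subsets[OF that] finite_verts] sccs_verts_linked[OF that]
      by (simp add: in_sccs_verts_conv_reachable)
    show "S \<inter> T = {} \<and> (\<forall>a\<in>S. \<forall>b\<in>T. \<not> ?E a b)"
      if "S \<in> sccs_verts" "T \<in> sccs_verts" "S \<noteq> T" for S T
      using sccs_verts_disjoint[OF that] sccs_verts_not_adjacent[OF that] by simp
  qed
  then show ?thesis
    unfolding Union_sccs_verts card_sccs_verts_num_components by (elim exE conjE) (rule that)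
qed

lemma energy_lower_bounds:
  assumes spec: "adjacency_eigenvalues G = image_mset e (mset_set {..<n})"
    and n: "n = card (verts G)" and vs: "distinct vs" "set vs = verts G" and c: "c = 1 \<or> c = - 1"
    and orth: "\<And>k l. k < n \<Longrightarrow> l < n \<Longrightarrow> pairing n (q k) (q l) = (if k = l then 1 else 0)"
    and exp: "\<And>i j. i < n \<Longrightarrow> j < n \<Longrightarrow>
      of_bool ((vs ! i, vs ! j) \<in> arcs_ends G) = (\<Sum>k<n. e k * (q k i * q k j))"
    and p: "0 < p"
  shows "p \<le> 2 \<Longrightarrow> (real n - real (num_components G)) powr (p / 2)
      \<le> (\<Sum>x\<in>#{#x \<in># adjacency_eigenvalues G. 0 < c * x#}. \<bar>x\<bar> powr p)"
    and "2 \<le> p \<Longrightarrow> real n - real (num_components G)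
      \<le> (\<Sum>x\<in>#{#x \<in># adjacency_eigenvalues G. 0 < c * x#}. \<bar>x\<bar> powr p)"
proof -
  define T where "T = {k. k < n \<and> 0 < c * e k}"
  have "length vs = n" using vs n by (metis distinct_card)
  then have bij: "bij_betw ((!) vs) {..<n} (verts G)"
    using bij_betw_nth[OF vs(1), of "{..<n}" "verts G"] vs(2) by simp
  have expc: "c * of_bool ((vs ! i, vs ! j) \<in> arcs_ends G) = (\<Sum>k<n. c * e k * (q k i * q k j))"
    if "i < n" "j < n" for i j
    unfolding exp[OF that] by (simp add: sum_distrib_left mult.assoc)
  obtain K where K: "separating (\<lambda>u v. (u, v) \<in> arcs_ends G) (verts G) K"
    "real n - real (num_components G) \<le> separation (\<lambda>u v. (u, v) \<in> arcs_ends G) (verts G) K"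
    using graph_separating_kernel n by metis
  have "separation (\<lambda>u v. (u, v) \<in> arcs_ends G) (verts G) K \<le> (\<Sum>k\<in>T. (c * e k)\<^sup>2)"
    unfolding T_def separating_reindex(2)[OF bij K(1), symmetric]
    by (rule separation_le_positive_square_sum[OF orth expc _ separating_reindex(1)[OF bij K(1)]])
      (use c in auto)
  with K(2) have sq: "real n - real (num_components G) \<le> (\<Sum>k\<in>T. (c * e k)\<^sup>2)" by simp
  obtain I where I: "I \<subseteq> verts G" "card I = num_components G"
    "\<And>u v. u \<in> I \<Longrightarrow> v \<in> I \<Longrightarrow> (u, v) \<notin> arcs_ends G"
    by (rule independent_transversal) blast
  define J where "J = {i. i < n \<and> vs ! i \<in> I}"
  have "(!) vs ` J = I"
    using I(1) bij_betw_imp_surj_on[OF bij] by (auto simp: J_def)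
  moreover have "inj_on ((!) vs) J"
    using bij_betw_imp_inj_on[OF bij] by (rule inj_on_subset) (auto simp: J_def)
  ultimately have cardJ: "card J = num_components G" using card_image I(2) by metis
  have "card T + card J \<le> n"
    unfolding T_def
    by (rule card_positive_eigenvalues_le[OF orth expc]) (auto simp: J_def I(3))
  then have card: "real (card T) \<le> real n - real (num_components G)" using cardJ by simp
  have "(\<Sum>x\<in>#{#x \<in># adjacency_eigenvalues G. 0 < c * x#}. \<bar>x\<bar> powr p) = (\<Sum>k\<in>T. \<bar>e k\<bar> powr p)"
    unfolding spec T_def sum_unfold_sum_mset
    by (simp add: filter_mset_image_mset image_mset.compositionality comp_def lessThan_def)
  also have "\<dots> = (\<Sum>k\<in>T. (c * e k) powr p)"
    using c by (intro sum.cong) (auto simp: T_def)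
  finally have eq: "(\<Sum>x\<in>#{#x \<in># adjacency_eigenvalues G. 0 < c * x#}. \<bar>x\<bar> powr p)
      = (\<Sum>k\<in>T. (c * e k) powr p)" .
  have T: "finite T" "\<And>k. k \<in> T \<Longrightarrow> 0 < c * e k" by (auto simp: T_def)
  show "p \<le> 2 \<Longrightarrow> (real n - real (num_components G)) powr (p / 2)
      \<le> (\<Sum>x\<in>#{#x \<in># adjacency_eigenvalues G. 0 < c * x#}. \<bar>x\<bar> powr p)"
    unfolding eq by (rule power_sum_bounds(1)[OF T sq card p])
  show "2 \<le> p \<Longrightarrow> real n - real (num_components G)
      \<le> (\<Sum>x\<in>#{#x \<in># adjacency_eigenvalues G. 0 < c * x#}. \<bar>x\<bar> powr p)"
    unfolding eq by (rule power_sum_bounds(2)[OF T sq card p])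
qed

end

theorem corollary4p4:
  fixes G :: "('a, 'b) pre_digraph" and p :: real
    and E :: "real \<Rightarrow> ('a, 'b) pre_digraph \<Rightarrow> real"
  assumes "graph G" and "p > 0" and "E \<in> {positive_energy, negative_energy}"
  shows "(p \<le> 2 \<longrightarrow> E p G \<ge> (real (card (verts G)) - real (num_components G)) powr (p / 2)) \<and>
         (p \<ge> 2 \<longrightarrow> E p G \<ge> real (card (verts G)) - real (num_components G))"
proof -
  interpret graph G by fact
  obtain vs where vs: "distinct vs" "set vs = verts G"
    using finite_distinct_list[OF finite_verts] by blast
  define n where "n = card (verts G)"
  have len: "length vs = n" using distinct_card[OF vs(1)] vs(2) by (simp add: n_def)
  define a where "a i j = (of_bool ((vs ! i, vs ! j) \<in> arcs_ends G) :: real)" for i j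
  have "a i j = a j i" for i j
    unfolding a_def using arcs_ends_symmetric[OF sym_arcs] by (intro arg_cong[of _ _ of_bool]) blast
  then have "\<exists>q e. (\<forall>k<n. \<forall>l<n. pairing n (q k) (q l) = (if k = l then 1 else 0)) \<and>
      (\<forall>k<n. \<forall>i<n. (\<Sum>j<n. a i j * q k j) = e k * q k i)"
    by (rule spectral_theorem)
  then obtain q e where qe: "\<forall>k<n. \<forall>l<n. pairing n (q k) (q l) = (if k = l then 1 else 0)"
      "\<forall>k<n. \<forall>i<n. (\<Sum>j<n. a i j * q k j) = e k * q k i"
    by (elim exE conjE)
  have orth: "pairing n (q k) (q l) = (if k = l then 1 else 0)" if "k < n" "l < n" for k l
    using qe(1) that by simp
  have eig: "(\<Sum>j<n. a i j * q k j) = e k * q k i" if "k < n" "i < n" for k i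
    using qe(2) that by simp
  have "proots (char_poly (mat n n (\<lambda>(i, j). a i j))) = image_mset e (mset_set {..<n})"
    by (rule orthonormal_expansion(2)[of n q a e]) (fact orth eig)+
  moreover have "adjacency_matrix G vs = mat n n (\<lambda>(i, j). a i j)"
    by (simp add: adjacency_matrix_def len a_def)
  ultimately have spec: "adjacency_eigenvalues G = image_mset e (mset_set {..<n})"
    unfolding adjacency_eigenvalues_eq[OF vs] by simp
  have exp: "of_bool ((vs ! i, vs ! j) \<in> arcs_ends G) = (\<Sum>k<n. e k * (q k i * q k j))"
    if "i < n" "j < n" for i j
    unfolding a_def[symmetric] by (rule orthonormal_expansion(1)[of n q a e]) (fact orth eig that)+
  define c :: real where "c = (if E = positive_energy then 1 else - 1)"
  have "E p G = (\<Sum>x\<in>#{#x \<in># adjacency_eigenvalues G. 0 < c * x#}. \<bar>x\<bar> powr p)"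
    using assms(3) by (auto simp: c_def positive_energy_def negative_energy_def)
  moreover have "c = 1 \<or> c = - 1" by (simp add: c_def)
  ultimately show ?thesis
    using energy_lower_bounds[of e n vs c q p] spec n_def vs orth exp assms(2) by simp
qed

end
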